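(* Let $G$ be an acyclic ADT network with a source $S$ and destinations $T_1,\dots,T_N$. Let $\mathcal C=\mathcal C_d\cup\mathcal C_m$, where: - $\mathcal C_d=\{(S,T_i,\mathcal X(S,T_i)) : i\in[1,K]\}$ with $\mathcal X(S,T_i)\cap\mathcal X(S,T_j)=\emptyset$ for $i\ne j$ in $[1,K]$ (a disjoint multicast); - $\mathcal C_m=\{(S,T_i,\mathcal X(S)) : i\in[K+1,N]\}$ (a multicast of all source processes). Then $(G,\mathcal C)$ is solvable if and only if both of the following hold: - $\mathrm{mincut}(S,\mathcal T')\ge\sum_{T_i\in\mathcal T'}|\mathcal X(S,T_i)|$ for every $\mathcal T'\subseteq\{T_1,\dots,T_K\}$; - $\mathrm{mincut}(S,T_j)\ge|\mathcal X(S)|$ for every $j\in[K+1,N]$.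
   Context: ADT network model. $G=(\mathcal V,\mathcal E)$ is a directed acyclic network of supernodes, each with input ports $I(V)$ and output ports $O(V)$. Edges go from output ports to input ports of other supernodes. Linear coding over a finite field $\mathbb F_q$: - An output port $e\in O(V)$ carries $Y(e)=\sum_{e'\in I(V)}\beta_{(e',e)}Y(e')$. At $S$, the term $\sum_k\alpha_{(k,e)}X(S,k)$ is added, where $\mathcal X(S)$ are the independent source processes. - An output port sends the same symbol on all of its outgoing edges. - An input port $e'$ receives $Y(e')=\sum_{(e,e')\in\mathcal E}Y(e)$, the sum taken over $\mathbb F_q$. - A destination $T$ outputs $Z(T,k)=\sum_{e'\in I(T)}\epsilon_{(e',(T,k))}Y(e')$. A connection $(S,T,\mathcal X')$ is established if $T$'s outputs equal $\mathcal X'$. $(G,\mathcal C)$ is solvable if a single coefficient choice establishes all connections. Following the paper's convention, the field size $q$ may be chosen as large as needed. For a set $\mathcal T'$ of supernodes, $\mathrm{mincut}(S,\mathcal T')=\min_\Omega\mathrm{rank}(G_\Omega)$, with the minimum over partitions $\Omega\cup\Omega^c$ of the supernodes with $S\in\Omega$ and $\mathcal T'\subseteq\Omega^c$. $G_\Omega$ is the $0$-$1$ incidence matrix of the edges from output ports of supernodes in $\Omega$ to input ports of supernodes in $\Omega^c$. *)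

theory Defs
  imports "HOL-Algebra.Ring" "Jordan_Normal_Form.DL_Rank"
begin

definition adt_network ::
  "'v set \<Rightarrow> ('v \<Rightarrow> 'p set) \<Rightarrow> ('v \<Rightarrow> 'p set) \<Rightarrow> ('p \<times> 'p) set \<Rightarrow> bool" where
  "adt_network V Ip Op E \<longleftrightarrow>
     finite V \<and>
     (\<forall>v\<in>V. finite (Ip v) \<and> finite (Op v)) \<and>
     (\<forall>v\<in>V. \<forall>w\<in>V. Ip v \<inter> Op w = {}) \<and>
     (\<forall>v\<in>V. \<forall>w\<in>V. v \<noteq> w \<longrightarrow> Ip v \<inter> Ip w = {} \<and> Op v \<inter> Op w = {}) \<and>
     (\<forall>(e, e')\<in>E. \<exists>v\<in>V. \<exists>w\<in>V. v \<noteq> w \<and> e \<in> Op v \<and> e' \<in> Ip w)"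

definition node_graph ::
  "'v set \<Rightarrow> ('v \<Rightarrow> 'p set) \<Rightarrow> ('v \<Rightarrow> 'p set) \<Rightarrow> ('p \<times> 'p) set \<Rightarrow> ('v \<times> 'v) set" where
  "node_graph V Ip Op E =
     {(v, w). v \<in> V \<and> w \<in> V \<and> (\<exists>e\<in>Op v. \<exists>e'\<in>Ip w. (e, e') \<in> E)}"

definition acyclic_adt_network ::
  "'v set \<Rightarrow> ('v \<Rightarrow> 'p set) \<Rightarrow> ('v \<Rightarrow> 'p set) \<Rightarrow> ('p \<times> 'p) set \<Rightarrow> bool" where
  "acyclic_adt_network V Ip Op E \<longleftrightarrow>
     adt_network V Ip Op E \<and> acyclic (node_graph V Ip Op E)"

text \<open>Linear code over a finite field F (HOL-Algebra ring record, carrier in nat) with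
  source S, source processes XS.  Y e is the global coding vector of the symbol on port e
  (coefficient of each source process X(S,k)); the equations below determine Y uniquely
  from alpha, beta on an acyclic network.  A connection (S,T,X') is represented by the
  pair (T,X'): it is established iff every output Z(T,k'), k' in X', equals X(S,k'),
  i.e. its coefficient vector is the unit vector of k'.\<close>

definition code_establishes ::
  "nat ring \<Rightarrow> 'v set \<Rightarrow> ('v \<Rightarrow> 'p set) \<Rightarrow> ('v \<Rightarrow> 'p set) \<Rightarrow> ('p \<times> 'p) set \<Rightarrow>
   'v \<Rightarrow> 'k set \<Rightarrow> ('v \<times> 'k set) set \<Rightarrow>
   ('k \<Rightarrow> 'p \<Rightarrow> nat) \<Rightarrow> ('p \<Rightarrow> 'p \<Rightarrow> nat) \<Rightarrow> ('p \<Rightarrow> 'v \<Rightarrow> 'k \<Rightarrow> nat) \<Rightarrow>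
   ('p \<Rightarrow> 'k \<Rightarrow> nat) \<Rightarrow> bool" where
  "code_establishes F V Ip Op E S XS C \<alpha> \<beta> \<epsilon> Y \<longleftrightarrow>
     (\<forall>k e. \<alpha> k e \<in> carrier F) \<and>
     (\<forall>e' e. \<beta> e' e \<in> carrier F) \<and>
     (\<forall>e' T k. \<epsilon> e' T k \<in> carrier F) \<and>
     (\<forall>e k. Y e k \<in> carrier F) \<and>
     (\<forall>v\<in>V. \<forall>e\<in>Op v. \<forall>k\<in>XS.
        Y e k = (\<Oplus>\<^bsub>F\<^esub>e'\<in>Ip v. \<beta> e' e \<otimes>\<^bsub>F\<^esub> Y e' k)
                \<oplus>\<^bsub>F\<^esub> (if v = S then \<alpha> k e else \<zero>\<^bsub>F\<^esub>)) \<and>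
     (\<forall>v\<in>V. \<forall>e'\<in>Ip v. \<forall>k\<in>XS.
        Y e' k = (\<Oplus>\<^bsub>F\<^esub>e\<in>{e. (e, e') \<in> E}. Y e k)) \<and>
     (\<forall>(T, X')\<in>C. \<forall>k'\<in>X'. \<forall>k\<in>XS.
        (\<Oplus>\<^bsub>F\<^esub>e'\<in>Ip T. \<epsilon> e' T k' \<otimes>\<^bsub>F\<^esub> Y e' k)
          = (if k = k' then \<one>\<^bsub>F\<^esub> else \<zero>\<^bsub>F\<^esub>))"

definition solvable ::
  "'v set \<Rightarrow> ('v \<Rightarrow> 'p set) \<Rightarrow> ('v \<Rightarrow> 'p set) \<Rightarrow> ('p \<times> 'p) set \<Rightarrow>
   'v \<Rightarrow> 'k set \<Rightarrow> ('v \<times> 'k set) set \<Rightarrow> bool" where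
  "solvable V Ip Op E S XS C \<longleftrightarrow>
     (\<exists>F :: nat ring. field F \<and> finite (carrier F) \<and>
        (\<exists>\<alpha> \<beta> \<epsilon> Y. code_establishes F V Ip Op E S XS C \<alpha> \<beta> \<epsilon> Y))"

definition cut_matrix ::
  "'v set \<Rightarrow> ('v \<Rightarrow> 'p::linorder set) \<Rightarrow> ('v \<Rightarrow> 'p set) \<Rightarrow> ('p \<times> 'p) set \<Rightarrow> 'v set \<Rightarrow> rat mat" where
  "cut_matrix V Ip Op E \<Omega> =
     (let rs = sorted_list_of_set (\<Union>v\<in>\<Omega>. Op v);
          cs = sorted_list_of_set (\<Union>w\<in>V - \<Omega>. Ip w)
      in mat (length rs) (length cs)
           (\<lambda>(i, j). if (rs ! i, cs ! j) \<in> E then 1 else 0))"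

definition mat_rank :: "rat mat \<Rightarrow> nat" where
  "mat_rank A = vec_space.rank (dim_row A) (A :: rat mat)"

definition mincut ::
  "'v set \<Rightarrow> ('v \<Rightarrow> 'p::linorder set) \<Rightarrow> ('v \<Rightarrow> 'p set) \<Rightarrow> ('p \<times> 'p) set \<Rightarrow> 'v \<Rightarrow> 'v set \<Rightarrow> nat" where
  "mincut V Ip Op E S Ts =
     Min {mat_rank (cut_matrix V Ip Op E \<Omega>) | \<Omega>. \<Omega> \<subseteq> V \<and> S \<in> \<Omega> \<and> Ts \<inter> \<Omega> = {}}"

end

theory Submission
  imports Defs "HOL-Computational_Algebra.Primes"
begin

section \<open>Disjoint multicast combined with multicast in ADT networks\<close>

text \<open>
  Necessity: over any field the symbols that cross a cut depend linearly on at most as many of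
  them as the rank of the cut matrix, and columns of a 0-1 matrix that are independent over some
  field are independent over the rationals.

  Sufficiency: the nodes are eliminated one by one. Choosing the code \<open>X\<close> of a node replaces a
  transfer matrix \<open>A\<close> by \<open>A + B X C\<close>, and the largest rank of this matrix is the minimum of the
  ranks of \<open>[A B]\<close> and \<open>[A; C]\<close>, which belong to the two cuts that differ in the side of the
  eliminated node. A single integral \<open>X\<close> attains the required rank for finitely many such cuts at
  once, so the cut conditions survive until no node is left, where they say that the transfer
  matrices have full rank. The disjoint multicast is treated as a multicast to a
  super-destination, undone by precoding at the source. The integral code thus obtained is
  reduced modulo a large prime.
\<close>

subsection \<open>Independence of columns and rank\<close>

text \<open>The cut matrices are ranked over the rationals while the code lives in a finite field,
  and reduction modulo a small prime can lower a rank. The construction therefore never divides: its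
  decoders are integral and correct up to a nonzero factor, and the final prime is chosen to divide
  none of these factors. The converse has to work in every characteristic.

  Eliminating a node leaves a matrix whose entries are no longer 0 and 1 and which belongs to no
  graph. The induction is hence about an arbitrary integral matrix between ports, with acyclicity
  kept as a rank function on the nodes.

  A single threshold, the number of processes, must serve all receivers at once, although an owner
  wants only its share. For this reason the super-destination has one input per process, wired from
  the owner of that process. Owners on the source side of a cut deliver their shares directly, so
  the cut itself only has to carry the demands beyond it, which is the condition on subsets of
  destinations.\<close>

lemma sum_eq_sum_support:
  assumes "finite A" "B \<subseteq> A" "\<And>e. e \<in> A \<Longrightarrow> e \<notin> B \<Longrightarrow> g e = 0"
  shows "sum g A = sum g B"
  using assms by (intro sum.mono_neutral_right) auto

text \<open>Used to pass from rational relations to relations in a field: coprime integers have a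
  combination equal to 1, and this identity survives in every characteristic.\<close>

lemma bezout_sum:
  fixes z :: "'b \<Rightarrow> int"
  assumes "finite J"
  shows "\<exists>a. (\<Sum>f\<in>J. a f * z f) = Gcd (z ` J)"
  using assms
proof (induction J rule: finite_induct)
  case empty
  then show ?case by simp
next
  case (insert x J)
  then obtain a where a: "(\<Sum>f\<in>J. a f * z f) = Gcd (z ` J)" by blast
  obtain u v where uv: "u * z x + v * Gcd (z ` J) = gcd (z x) (Gcd (z ` J))"
    using bezout_int by blast
  have "(\<Sum>f\<in>J. (if f = x then u else v * a f) * z f) = v * (\<Sum>f\<in>J. a f * z f)"
    unfolding sum_distrib_left using insert.hyps by (intro sum.cong) auto
  then have "(\<Sum>f\<in>insert x J. (if f = x then u else v * a f) * z f) = Gcd (z ` insert x J)"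
    using insert.hyps a uv by simp
  then show ?case by (intro exI[of _ "\<lambda>f. if f = x then u else v * a f"])
qed

text \<open>Gaussian elimination of one equation at a time: equation \<open>i\<close> is solved for
  a pivot \<open>j0\<close>, and the other equations are modified so that the pivot drops out of
  them.\<close>

lemma homogeneous_system_nontrivial:
  fixes a :: "'i \<Rightarrow> 'j \<Rightarrow> 'f::field"
  assumes "finite I" "finite J" "card I < card J"
  shows "\<exists>c. (\<exists>j\<in>J. c j \<noteq> 0) \<and> (\<forall>i\<in>I. (\<Sum>j\<in>J. c j * a i j) = 0)"
  using assms
proof (induction I arbitrary: J a rule: finite_induct)
  case empty
  then obtain j where "j \<in> J" by fastforce
  then show ?case by (intro exI[of _ "\<lambda>_. 1"]) auto
next
  case (insert i I)
  show ?case
  proof (cases "\<forall>j\<in>J. a i j = 0")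
    case True
    have "card I < card J" using insert by simp
    from insert.IH[OF insert.prems(1) this, of a] obtain c where
      c: "\<exists>j\<in>J. c j \<noteq> 0" "\<forall>k\<in>I. (\<Sum>j\<in>J. c j * a k j) = 0" by blast
    with True have "(\<Sum>j\<in>J. c j * a i j) = 0" by simp
    with c show ?thesis by (intro exI[of _ c]) auto
  next
    case False
    then obtain j0 where j0: "j0 \<in> J" "a i j0 \<noteq> 0" by blast
    define J' where "J' = J - {j0}"
    have J': "finite J'" "j0 \<notin> J'" "J = insert j0 J'"
      using j0 insert.prems(1) by (auto simp: J'_def)
    then have "card I < card J'" using insert by auto
    from insert.IH[OF J'(1) this, of "\<lambda>k j. a k j - a i j * a k j0 / a i j0"] obtain c where
      c: "\<exists>j\<in>J'. c j \<noteq> 0"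
         "\<And>k. k \<in> I \<Longrightarrow> (\<Sum>j\<in>J'. c j * (a k j - a i j * a k j0 / a i j0)) = 0" by blast
    define s where "s = (\<Sum>j\<in>J'. c j * a i j)"
    define d where "d = c(j0 := - s / a i j0)"
    have d: "(\<Sum>j\<in>J. d j * a k j) = (\<Sum>j\<in>J'. c j * a k j) - s * a k j0 / a i j0" for k
    proof -
      have "(\<Sum>j\<in>J'. d j * a k j) = (\<Sum>j\<in>J'. c j * a k j)"
        using J'(2) by (intro sum.cong) (auto simp: d_def)
      then show ?thesis using J' by (simp add: d_def)
    qed
    have "(\<Sum>j\<in>J. d j * a k j) = 0" if "k \<in> insert i I" for k
    proof (cases "k = i")
      case True
      then show ?thesis using j0(2) by (simp add: d s_def)
    next
      case False
      then have "k \<in> I" using that by simp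
      from c(2)[OF this] show ?thesis
        by (simp add: d s_def algebra_simps sum_subtractf sum_divide_distrib sum_distrib_left sum_distrib_right)
    qed
    moreover have "\<exists>j\<in>J. d j \<noteq> 0" using c(1) J' by (auto simp: d_def)
    ultimately show ?thesis by blast
  qed
qed

text \<open>Column \<open>f\<close> of \<open>g\<close> is the family \<open>\<lambda>e. g e f\<close>. Independence is that of the indexed family, so two equal
  columns with different indices are dependent.\<close>

definition indep_cols :: "'a set \<Rightarrow> 'b set \<Rightarrow> ('a \<Rightarrow> 'b \<Rightarrow> 'f::field) \<Rightarrow> bool" where
  "indep_cols R J g \<longleftrightarrow> (\<forall>c. (\<forall>e\<in>R. (\<Sum>f\<in>J. c f * g e f) = 0) \<longrightarrow> (\<forall>f\<in>J. c f = 0))"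

definition rk :: "'a set \<Rightarrow> 'b set \<Rightarrow> ('a \<Rightarrow> 'b \<Rightarrow> 'f::field) \<Rightarrow> nat" where
  "rk R C g = Max (card ` {J. J \<subseteq> C \<and> indep_cols R J g})"

definition col_in_span :: "'a set \<Rightarrow> 'b set \<Rightarrow> ('a \<Rightarrow> 'b \<Rightarrow> 'f::field) \<Rightarrow> ('a \<Rightarrow> 'f) \<Rightarrow> bool" where
  "col_in_span R C g h \<longleftrightarrow> (\<exists>a. \<forall>e\<in>R. h e = (\<Sum>j\<in>C. a j * g e j))"

lemma indep_cols_empty [simp]: "indep_cols R {} g"
  by (simp add: indep_cols_def)

lemma indep_cols_cong:
  assumes "\<And>e f. e \<in> R \<Longrightarrow> f \<in> J \<Longrightarrow> g e f = h e f"
  shows "indep_cols R J g \<longleftrightarrow> indep_cols R J h"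
proof -
  have "(\<Sum>f\<in>J. c f * g e f) = (\<Sum>f\<in>J. c f * h e f)" if "e \<in> R" for c e
    using assms that by (intro sum.cong) auto
  then show ?thesis unfolding indep_cols_def by auto
qed

lemma rk_cong:
  assumes "\<And>e f. e \<in> R \<Longrightarrow> f \<in> C \<Longrightarrow> g e f = h e f"
  shows "rk R C g = rk R C h"
proof -
  have "indep_cols R J g \<longleftrightarrow> indep_cols R J h" if "J \<subseteq> C" for J
    using assms that by (intro indep_cols_cong) auto
  then have "{J. J \<subseteq> C \<and> indep_cols R J g} = {J. J \<subseteq> C \<and> indep_cols R J h}" by auto
  then show ?thesis by (simp add: rk_def)
qed

lemma card_le_rk:
  assumes "finite C" "J \<subseteq> C" "indep_cols R J g"
  shows "card J \<le> rk R C g"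
proof -
  have "finite {J. J \<subseteq> C \<and> indep_cols R J g}"
    using assms(1) by (rule finite_subset[rotated, OF finite_Pow_iff[THEN iffD2]]) auto
  then show ?thesis unfolding rk_def using assms by (intro Max_ge) auto
qed

lemma rk_basis_exists:
  assumes "finite C"
  obtains J where "J \<subseteq> C" "indep_cols R J g" "card J = rk R C g" "finite J"
proof -
  have "finite {J. J \<subseteq> C \<and> indep_cols R J g}"
    using assms(1) by (rule finite_subset[rotated, OF finite_Pow_iff[THEN iffD2]]) auto
  moreover have "{} \<in> {J. J \<subseteq> C \<and> indep_cols R J g}" by simp
  ultimately have "rk R C g \<in> card ` {J. J \<subseteq> C \<and> indep_cols R J g}"
    unfolding rk_def by (intro Max_in) auto
  then obtain J where "J \<subseteq> C" "indep_cols R J g" "rk R C g = card J" by auto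
  then show ?thesis using that[of J] finite_subset[OF _ assms, of J] by simp
qed

lemma col_in_span_superset:
  assumes "col_in_span R J g h" "J \<subseteq> C" "finite C"
  shows "col_in_span R C g h"
proof -
  obtain a where a: "\<forall>e\<in>R. h e = (\<Sum>j\<in>J. a j * g e j)" using assms(1) unfolding col_in_span_def by blast
  have "(\<Sum>j\<in>C. (if j \<in> J then a j else 0) * g e j) = (\<Sum>j\<in>J. a j * g e j)" for e
    using assms(2,3) by (intro sum.mono_neutral_cong_right) auto
  then show ?thesis using a unfolding col_in_span_def
    by (intro exI[of _ "\<lambda>j. if j \<in> J then a j else 0"]) auto
qed

lemma col_in_span_member:
  assumes "f \<in> C" "finite C"
  shows "col_in_span R C g (\<lambda>e. g e f)"
proof -
  have "(\<Sum>j\<in>C. (if j = f then 1 else 0) * g e j) = g e f" for e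
    using assms by (simp add: if_distrib[of "\<lambda>x. x * _"] cong: if_cong)
  then show ?thesis unfolding col_in_span_def
    by (intro exI[of _ "\<lambda>j. if j = f then 1 else 0"]) auto
qed

lemma col_in_span_lincomb:
  assumes "\<And>i. i \<in> I \<Longrightarrow> col_in_span R C g (h i)"
  shows "col_in_span R C g (\<lambda>e. \<Sum>i\<in>I. b i * h i e)"
proof -
  obtain a where a: "\<And>i. i \<in> I \<Longrightarrow> \<forall>e\<in>R. h i e = (\<Sum>j\<in>C. a i j * g e j)"
    using assms unfolding col_in_span_def by metis
  have "(\<Sum>i\<in>I. b i * h i e) = (\<Sum>j\<in>C. (\<Sum>i\<in>I. b i * a i j) * g e j)" if "e \<in> R" for e
  proof -
    have "(\<Sum>i\<in>I. b i * h i e) = (\<Sum>i\<in>I. b i * (\<Sum>j\<in>C. a i j * g e j))"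
      using a that by (intro sum.cong) auto
    also have "\<dots> = (\<Sum>j\<in>C. \<Sum>i\<in>I. b i * (a i j * g e j))"
      by (simp add: sum_distrib_left) (rule sum.swap)
    finally show ?thesis by (simp add: sum_distrib_right mult.assoc)
  qed
  then show ?thesis unfolding col_in_span_def
    by (intro exI[of _ "\<lambda>j. \<Sum>i\<in>I. b i * a i j"]) simp
qed

lemma col_in_span_add_scaled:
  assumes "col_in_span R C g h" "col_in_span R C g h'"
  shows "col_in_span R C g (\<lambda>e. h e + t * h' e)"
  using col_in_span_lincomb[of "UNIV :: bool set" R C g "\<lambda>i. if i then h else h'" "\<lambda>i. if i then 1 else t"] assms
  by (simp add: UNIV_bool add.commute)

lemma col_in_span_trans:
  assumes "col_in_span R C g h" "\<And>f. f \<in> C \<Longrightarrow> col_in_span R J g' (\<lambda>e. g e f)"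
  shows "col_in_span R J g' h"
proof -
  obtain a where a: "\<forall>e\<in>R. h e = (\<Sum>j\<in>C. a j * g e j)" using assms(1) unfolding col_in_span_def by blast
  have "col_in_span R J g' (\<lambda>e. \<Sum>j\<in>C. a j * g e j)"
    using assms(2) by (rule col_in_span_lincomb)
  then show ?thesis using a unfolding col_in_span_def by auto
qed

lemma indep_cols_insert:
  assumes "finite J" "indep_cols R J g" "f \<notin> J" "\<not> col_in_span R J g (\<lambda>e. g e f)"
  shows "indep_cols R (insert f J) g"
  unfolding indep_cols_def
proof (intro allI impI)
  fix c assume "\<forall>e\<in>R. (\<Sum>f\<in>insert f J. c f * g e f) = 0"
  then have c: "c f * g e f + (\<Sum>f\<in>J. c f * g e f) = 0" if "e \<in> R" for e
    using assms(1,3) that by simp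
  have "c f = 0"
  proof (rule ccontr)
    assume cf: "c f \<noteq> 0"
    have "g e f = (\<Sum>j\<in>J. (- c j / c f) * g e j)" if "e \<in> R" for e
    proof -
      have "g e f = - (\<Sum>f\<in>J. c f * g e f) / c f"
        using c[OF that] cf by (simp add: field_simps eq_neg_iff_add_eq_0)
      then show ?thesis by (simp add: sum_divide_distrib sum_negf)
    qed
    then have "col_in_span R J g (\<lambda>e. g e f)"
      unfolding col_in_span_def by (intro exI[of _ "\<lambda>j. - c j / c f"]) auto
    then show False using assms(4) by blast
  qed
  moreover have "\<forall>e\<in>R. (\<Sum>f\<in>J. c f * g e f) = 0"
    using c \<open>c f = 0\<close> by simp
  then have "\<forall>f\<in>J. c f = 0"
    using assms(2) unfolding indep_cols_def by blast
  ultimately show "\<forall>f\<in>insert f J. c f = 0" by blast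
qed

lemma rk_basis_spans:
  assumes "finite C" "J \<subseteq> C" "indep_cols R J g" "card J = rk R C g" "f \<in> C"
  shows "col_in_span R J g (\<lambda>e. g e f)"
proof (rule ccontr)
  have fJ: "finite J" using assms(2,1) by (rule finite_subset)
  assume n: "\<not> ?thesis"
  then have "f \<notin> J" using col_in_span_member[OF _ fJ] by blast
  then have "indep_cols R (insert f J) g" "card (insert f J) = Suc (card J)"
    using indep_cols_insert[OF fJ assms(3)] n fJ by auto
  then show False using card_le_rk[of C "insert f J" R g] assms by auto
qed

text \<open>Steinitz bound: with more spanned columns than spanning ones, the homogeneous system of
  their coefficients has a nontrivial solution, which is a relation among the columns of
  \<open>h\<close>.\<close>

lemma card_le_if_spanned:
  assumes "finite I" "finite J" "indep_cols R I h" "\<And>i. i \<in> I \<Longrightarrow> col_in_span R J g (\<lambda>e. h e i)"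
  shows "card I \<le> card J"
proof (rule ccontr)
  assume "\<not> ?thesis"
  then have lt: "card J < card I" by simp
  have "\<forall>i\<in>I. \<exists>a. \<forall>e\<in>R. h e i = (\<Sum>j\<in>J. a j * g e j)"
    using assms(4) unfolding col_in_span_def by simp
  from bchoice[OF this] obtain a where
    a: "\<And>i. i \<in> I \<Longrightarrow> \<forall>e\<in>R. h e i = (\<Sum>j\<in>J. a i j * g e j)" by blast
  from homogeneous_system_nontrivial[OF assms(2,1) lt, of "\<lambda>j i. a i j"] obtain c where
    c: "\<exists>i\<in>I. c i \<noteq> 0" "\<And>j. j \<in> J \<Longrightarrow> (\<Sum>i\<in>I. c i * a i j) = 0" by blast
  have "(\<Sum>i\<in>I. c i * h e i) = 0" if "e \<in> R" for e
  proof -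
    have "(\<Sum>i\<in>I. c i * h e i) = (\<Sum>i\<in>I. c i * (\<Sum>j\<in>J. a i j * g e j))"
      using a that by (intro sum.cong) auto
    also have "\<dots> = (\<Sum>j\<in>J. \<Sum>i\<in>I. c i * (a i j * g e j))"
      by (simp add: sum_distrib_left) (rule sum.swap)
    also have "\<dots> = (\<Sum>j\<in>J. (\<Sum>i\<in>I. c i * a i j) * g e j)"
      by (simp add: sum_distrib_right mult.assoc)
    finally show ?thesis using c(2) by simp
  qed
  then show False using assms(3) c(1) unfolding indep_cols_def by blast
qed

lemma card_le_rk_if_spanned:
  assumes "finite C" "finite I" "indep_cols R I h" "\<And>i. i \<in> I \<Longrightarrow> col_in_span R C g (\<lambda>e. h e i)"
  shows "card I \<le> rk R C g"
proof -
  obtain J where J: "J \<subseteq> C" "indep_cols R J g" "card J = rk R C g" "finite J"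
    by (rule rk_basis_exists[OF assms(1)])
  have "col_in_span R J g (\<lambda>e. h e i)" if "i \<in> I" for i
    using assms(4)[OF that] rk_basis_spans[OF assms(1) J(1-3)] by (rule col_in_span_trans)
  then show ?thesis using card_le_if_spanned[OF assms(2) J(4) assms(3), of g] J(3) by simp
qed

subsection \<open>Rank and linear coding at one node\<close>

text \<open>\<open>b\<close> is a bare column without an index in the matrix; the option type
  supplies the index \<open>None\<close> for it.\<close>

lemma indep_cols_option_insert:
  assumes "finite J" "indep_cols R J g" "\<not> col_in_span R J g b"
  shows "indep_cols R (insert None (Some ` J)) (\<lambda>e i. case i of None \<Rightarrow> b e | Some f \<Rightarrow> g e f)"
    (is "indep_cols R _ ?h")
proof (rule indep_cols_insert)
  show "indep_cols R (Some ` J) ?h"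
    using assms(2) unfolding indep_cols_def
    by (auto simp: sum.reindex dest: spec[of _ "\<lambda>f. _ (Some f)"])
  show "\<not> col_in_span R (Some ` J) ?h (\<lambda>e. ?h e None)"
  proof
    assume "col_in_span R (Some ` J) ?h (\<lambda>e. ?h e None)"
    then obtain a where "\<forall>e\<in>R. b e = (\<Sum>f\<in>J. a (Some f) * g e f)"
      by (auto simp: col_in_span_def sum.reindex)
    then have "col_in_span R J g b"
      unfolding col_in_span_def by (intro exI[of _ "\<lambda>f. a (Some f)"])
    then show False using assms(3) by blast
  qed
qed (use assms(1) in auto)

text \<open>Applied to \<open>z\<close>, the updated matrix leaves a nonzero multiple of
  \<open>b\<close>, because \<open>z\<close> lies in the kernel of \<open>g\<close>. So
  \<open>b\<close> is in the new column span, hence so are the old columns, and the new span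
  contains the old one together with the independent \<open>b\<close>.\<close>

lemma rk_rank_one_update_gt:
  assumes fin: "finite C"
    and b: "\<not> col_in_span R C g b"
    and z: "\<And>e. e \<in> R \<Longrightarrow> (\<Sum>f\<in>C. z f * g e f) = 0"
    and zc: "(\<Sum>f\<in>C. z f * c f) \<noteq> 0"
    and t: "t \<noteq> 0"
  shows "rk R C g < rk R C (\<lambda>e f. g e f + t * b e * c f)" (is "_ < rk R C ?g'")
proof -
  define k where "k = (\<Sum>f\<in>C. z f * c f)"
  obtain J where J: "J \<subseteq> C" "indep_cols R J g" "card J = rk R C g" "finite J"
    by (rule rk_basis_exists[OF fin])
  have b': "col_in_span R C ?g' b"
  proof -
    have "b e = (\<Sum>f\<in>C. (z f / (t * k)) * ?g' e f)" if "e \<in> R" for e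
    proof -
      have "(\<Sum>f\<in>C. z f * ?g' e f) = (\<Sum>f\<in>C. z f * g e f) + t * b e * k"
        by (simp add: k_def sum_distrib_left algebra_simps sum.distrib)
      also have "\<dots> = t * b e * k" using z[OF that] by simp
      finally have "(\<Sum>f\<in>C. z f * ?g' e f) / (t * k) = b e"
        using t zc by (simp add: k_def)
      then show ?thesis by (simp add: sum_divide_distrib)
    qed
    then show ?thesis unfolding col_in_span_def
      by (intro exI[of _ "\<lambda>f. z f / (t * k)"]) auto
  qed
  define h where "h = (\<lambda>e i. case i of None \<Rightarrow> b e | Some f \<Rightarrow> g e f)"
  have "\<not> col_in_span R J g b"
    using col_in_span_superset[OF _ J(1) fin] b by blast
  then have "indep_cols R (insert None (Some ` J)) h"
    unfolding h_def by (rule indep_cols_option_insert[OF J(4,2)])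
  moreover have "col_in_span R C ?g' (\<lambda>e. h e i)" if i: "i \<in> insert None (Some ` J)" for i
  proof (cases i)
    case None
    then show ?thesis using b' by (simp add: h_def)
  next
    case (Some f)
    then have "f \<in> C" using i J(1) by auto
    from col_in_span_add_scaled[OF col_in_span_member[OF this fin, of R ?g'] b', of "- t * c f"]
    show ?thesis by (simp add: h_def Some algebra_simps)
  qed
  ultimately have "card (insert None (Some ` J)) \<le> rk R C ?g'"
    using J(4) by (intro card_le_rk_if_spanned[OF fin]) auto
  then show ?thesis using J(3,4) by (simp add: card_image)
qed

text \<open>A nonzero maximal minor of \<open>g\<close> becomes an affine function of the amount
  under a rank-one update, so it vanishes for at most one amount. The argument avoids determinants:
  a drop at \<open>t\<close> gives a combination of basis columns of \<open>g\<close> that is a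
  multiple of \<open>b\<close>, with a factor involving \<open>t\<close>.\<close>

lemma rk_rank_one_update_drop_unique:
  assumes fin: "finite C"
    and t: "rk R C (\<lambda>e f. g e f + t * b e * c f) < rk R C g"
    and t': "rk R C (\<lambda>e f. g e f + t' * b e * c f) < rk R C g"
  shows "t = t'"
proof -
  obtain J where J: "J \<subseteq> C" "indep_cols R J g" "card J = rk R C g" "finite J"
    by (rule rk_basis_exists[OF fin])
  have dep: "\<exists>z. (\<exists>f\<in>J. z f \<noteq> 0) \<and>
      (\<forall>e\<in>R. (\<Sum>f\<in>J. z f * g e f) = - (t * (\<Sum>f\<in>J. z f * c f)) * b e)"
    if lt: "rk R C (\<lambda>e f. g e f + t * b e * c f) < rk R C g" for t
  proof -
    have "\<not> indep_cols R J (\<lambda>e f. g e f + t * b e * c f)"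
      using card_le_rk[OF fin J(1), of R "\<lambda>e f. g e f + t * b e * c f"] lt J(3) by auto
    then obtain z where z: "\<exists>f\<in>J. z f \<noteq> 0"
      "\<And>e. e \<in> R \<Longrightarrow> (\<Sum>f\<in>J. z f * (g e f + t * b e * c f)) = 0"
      unfolding indep_cols_def by blast
    have "(\<Sum>f\<in>J. z f * (g e f + t * b e * c f))
        = (\<Sum>f\<in>J. z f * g e f) + t * (\<Sum>f\<in>J. z f * c f) * b e" for e
      by (simp add: sum_distrib_left sum_distrib_right algebra_simps sum.distrib)
    then show ?thesis using z by (intro exI[of _ z]) (auto simp: eq_neg_iff_add_eq_0)
  qed
  obtain z where z: "\<exists>f\<in>J. z f \<noteq> 0"
    "\<And>e. e \<in> R \<Longrightarrow> (\<Sum>f\<in>J. z f * g e f) = - (t * (\<Sum>f\<in>J. z f * c f)) * b e"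
    using dep[OF t] by blast
  obtain z' where z': "\<exists>f\<in>J. z' f \<noteq> 0"
    "\<And>e. e \<in> R \<Longrightarrow> (\<Sum>f\<in>J. z' f * g e f) = - (t' * (\<Sum>f\<in>J. z' f * c f)) * b e"
    using dep[OF t'] by blast
  define k where "k = (\<Sum>f\<in>J. z f * c f)"
  define k' where "k' = (\<Sum>f\<in>J. z' f * c f)"
  have k0: "k \<noteq> 0"
  proof
    assume "k = 0"
    then have "\<forall>e\<in>R. (\<Sum>f\<in>J. z f * g e f) = 0" using z(2) by (simp add: k_def)
    then show False using z(1) J(2) unfolding indep_cols_def by blast
  qed
  have k0': "k' \<noteq> 0"
  proof
    assume "k' = 0"
    then have "\<forall>e\<in>R. (\<Sum>f\<in>J. z' f * g e f) = 0" using z'(2) by (simp add: k'_def)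
    then show False using z'(1) J(2) unfolding indep_cols_def by blast
  qed
  \<comment> \<open>The weights cancel the two multiples of \<open>b\<close>, so by independence the
    weighted vectors agree on \<open>J\<close>; pairing them with \<open>c\<close> then compares
    \<open>t\<close> and \<open>t'\<close>.\<close>
  have "(\<Sum>f\<in>J. (t' * k' * z f - t * k * z' f) * g e f) = 0" if "e \<in> R" for e
  proof -
    have "(\<Sum>f\<in>J. (t' * k' * z f - t * k * z' f) * g e f)
        = t' * k' * (\<Sum>f\<in>J. z f * g e f) - t * k * (\<Sum>f\<in>J. z' f * g e f)"
      by (simp add: sum_distrib_left algebra_simps sum_subtractf)
    then show ?thesis
      using z(2)[OF that] z'(2)[OF that] by (simp add: k_def[symmetric] k'_def[symmetric])
  qed
  then have eq: "t' * k' * z f = t * k * z' f" if "f \<in> J" for f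
    using spec[OF J(2)[unfolded indep_cols_def], of "\<lambda>f. t' * k' * z f - t * k * z' f"] that by simp
  have "t' * k' * k = (\<Sum>f\<in>J. t' * k' * z f * c f)"
    by (simp add: k_def sum_distrib_left mult.assoc)
  also have "\<dots> = (\<Sum>f\<in>J. t * k * z' f * c f)" using eq by simp
  also have "\<dots> = t * k * k'" by (simp add: k'_def sum_distrib_left mult.assoc)
  finally show ?thesis using k0 k0' by simp
qed

text \<open>Substituting a linear code \<open>X\<close> for a node with input ports \<open>P\<close> and output ports \<open>Q\<close> into the
  transfer matrix \<open>g\<close>, which maps symbols on output ports to symbols on input ports.\<close>

definition elim_block ::
  "'b set \<Rightarrow> 'a set \<Rightarrow> ('b \<Rightarrow> 'a \<Rightarrow> 'f) \<Rightarrow> ('a \<Rightarrow> 'b \<Rightarrow> 'f::field) \<Rightarrow> 'a \<Rightarrow> 'b \<Rightarrow> 'f" where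
  "elim_block P Q X g = (\<lambda>e f. g e f + (\<Sum>p\<in>P. \<Sum>q\<in>Q. g e p * X p q * g q f))"

lemma elim_block_alt:
  "elim_block P Q X g e f = g e f + (\<Sum>p\<in>P. (\<Sum>q\<in>Q. X p q * g q f) * g e p)"
  by (simp add: elim_block_def sum_distrib_left sum_distrib_right mult_ac)

lemma elim_block_alt':
  "elim_block P Q X g e f = g e f + (\<Sum>q\<in>Q. (\<Sum>p\<in>P. g e p * X p q) * g q f)"
  by (simp add: elim_block_def sum_distrib_right) (rule sum.swap)

lemma elim_block_single:
  assumes "finite P" "finite Q" "p \<in> P" "q \<in> Q"
  shows "elim_block P Q (\<lambda>p' q'. X p' q' + (if p' = p \<and> q' = q then t else 0)) g
    = (\<lambda>e f. elim_block P Q X g e f + t * g e p * g q f)"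
proof (intro ext)
  fix e f
  have "(\<Sum>p'\<in>P. \<Sum>q'\<in>Q. g e p' * (if p' = p \<and> q' = q then t else 0) * g q' f)
      = (\<Sum>p'\<in>P. if p' = p then (\<Sum>q'\<in>Q. if q' = q then g e p * t * g q f else 0) else 0)"
    by (intro sum.cong) (auto intro!: sum.cong sum.neutral)
  also have "\<dots> = t * g e p * g q f" using assms by simp
  finally have s: "(\<Sum>p'\<in>P. \<Sum>q'\<in>Q. g e p' * (if p' = p \<and> q' = q then t else 0) * g q' f)
    = t * g e p * g q f" .
  show "elim_block P Q (\<lambda>p' q'. X p' q' + (if p' = p \<and> q' = q then t else 0)) g e f
    = elim_block P Q X g e f + t * g e p * g q f"
    unfolding elim_block_def s[symmetric] by (simp add: algebra_simps sum.distrib)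
qed

text \<open>If all columns in \<open>P\<close> lay in the span of the new matrix, so would the
  columns of \<open>g\<close> in \<open>C\<close>, against \<open>col\<close>; this gives
  \<open>p\<close>. A basis for the rows \<open>R \<union> Q\<close> satisfies a relation in the new
  matrix on \<open>R\<close>. If that relation also held on all rows in \<open>Q\<close>, it would
  hold for \<open>g\<close> on \<open>R \<union> Q\<close>, against independence; this gives
  \<open>q\<close>. The update at \<open>p\<close> and \<open>q\<close> then has a column outside
  the span and a row that is nonzero on a kernel vector.\<close>

lemma elim_block_improvable:
  fixes g :: "'a \<Rightarrow> 'b \<Rightarrow> 'f::field"
  assumes fin: "finite C" "finite P" "finite Q"
    and col: "rk R C (elim_block P Q X g) < rk R (C \<union> P) g"
    and row: "rk R C (elim_block P Q X g) < rk (R \<union> Q) C g"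
  shows "\<exists>p\<in>P. \<exists>q\<in>Q. \<forall>t. t \<noteq> 0 \<longrightarrow> rk R C (elim_block P Q X g)
    < rk R C (\<lambda>e f. elim_block P Q X g e f + t * g e p * g q f)"
proof -
  let ?g = "elim_block P Q X g"
  have "\<exists>p\<in>P. \<not> col_in_span R C ?g (\<lambda>e. g e p)"
  proof (rule ccontr)
    assume "\<not> ?thesis"
    then have P: "col_in_span R C ?g (\<lambda>e. g e p)" if "p \<in> P" for p using that by blast
    have "col_in_span R C ?g (\<lambda>e. g e f)" if f: "f \<in> C" for f
    proof -
      have "col_in_span R C ?g (\<lambda>e. ?g e f + (-1) * (\<Sum>p\<in>P. (\<Sum>q\<in>Q. X p q * g q f) * g e p))"
        using col_in_span_member[OF f fin(1)] P
        by (intro col_in_span_add_scaled col_in_span_lincomb)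
      then show ?thesis by (simp add: elim_block_alt)
    qed
    with P have CP: "col_in_span R C ?g (\<lambda>e. g e f)" if "f \<in> C \<union> P" for f using that by blast
    obtain J where J: "J \<subseteq> C \<union> P" "indep_cols R J g" "card J = rk R (C \<union> P) g" "finite J"
      by (rule rk_basis_exists[OF finite_UnI[OF fin(1,2)]])
    have "card J \<le> rk R C ?g"
      using J(1) CP by (intro card_le_rk_if_spanned[OF fin(1) J(4,2)]) auto
    then show False using J(3) col by simp
  qed
  then obtain p where p: "p \<in> P" "\<not> col_in_span R C ?g (\<lambda>e. g e p)" by blast
  obtain J where J: "J \<subseteq> C" "indep_cols (R \<union> Q) J g" "card J = rk (R \<union> Q) C g" "finite J"
    by (rule rk_basis_exists[OF fin(1)])
  have "\<not> indep_cols R J ?g" using card_le_rk[OF fin(1) J(1), of R ?g] J(3) row by auto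
  then obtain c where c: "\<exists>f\<in>J. c f \<noteq> 0" "\<And>e. e \<in> R \<Longrightarrow> (\<Sum>f\<in>J. c f * ?g e f) = 0"
    unfolding indep_cols_def by blast
  have "\<exists>q\<in>Q. (\<Sum>f\<in>J. c f * g q f) \<noteq> 0"
  proof (rule ccontr)
    assume "\<not> ?thesis"
    then have Q: "(\<Sum>f\<in>J. c f * g q f) = 0" if "q \<in> Q" for q using that by blast
    have "(\<Sum>f\<in>J. c f * g e f) = 0" if e: "e \<in> R" for e
    proof -
      have "(\<Sum>f\<in>J. c f * ?g e f) = (\<Sum>f\<in>J. c f * g e f)
          + (\<Sum>f\<in>J. \<Sum>q\<in>Q. c f * ((\<Sum>p\<in>P. g e p * X p q) * g q f))"
        by (simp add: elim_block_alt' distrib_left sum.distrib sum_distrib_left)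
      also have "(\<Sum>f\<in>J. \<Sum>q\<in>Q. c f * ((\<Sum>p\<in>P. g e p * X p q) * g q f))
          = (\<Sum>q\<in>Q. (\<Sum>p\<in>P. g e p * X p q) * (\<Sum>f\<in>J. c f * g q f))"
        by (subst sum.swap) (simp add: sum_distrib_left mult.left_commute)
      finally show ?thesis using c(2)[OF e] Q by simp
    qed
    then have "\<forall>f\<in>J. c f = 0" using Q J(2) unfolding indep_cols_def by blast
    then show False using c(1) by blast
  qed
  then obtain q where q: "q \<in> Q" "(\<Sum>f\<in>J. c f * g q f) \<noteq> 0" by blast
  define z where "z = (\<lambda>f. if f \<in> J then c f else 0)"
  have z: "(\<Sum>f\<in>C. z f * y f) = (\<Sum>f\<in>J. c f * y f)" for y
    using J(1) fin(1) by (intro sum.mono_neutral_cong_right) (auto simp: z_def)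
  show ?thesis
    using p q c(2) rk_rank_one_update_gt[OF fin(1) p(2), of z "\<lambda>f. g q f"]
    by (intro bexI[of _ p] bexI[of _ q]) (auto simp: z)
qed

text \<open>As long as some rank is deficient, a single entry of \<open>X\<close> can be changed by any nonzero amount to
  improve it, and all but at most one amount preserve each of the other ranks.\<close>

lemma common_block_exists:
  fixes g :: "'a \<Rightarrow> 'b \<Rightarrow> 'f::field_char_0"
  assumes fin: "finite P" "finite Q" "finite \<C>" "\<And>R C. (R, C) \<in> \<C> \<Longrightarrow> finite C"
    and col: "\<And>R C. (R, C) \<in> \<C> \<Longrightarrow> r \<le> rk R (C \<union> P) g"
    and row: "\<And>R C. (R, C) \<in> \<C> \<Longrightarrow> r \<le> rk (R \<union> Q) C g"
  shows "\<exists>X. (\<forall>p q. X p q \<in> \<int>) \<and> (\<forall>(R, C)\<in>\<C>. r \<le> rk R C (elim_block P Q X g))"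
proof -
  \<comment> \<open>Capping each rank at \<open>r\<close> bounds the potential, so a maximal
    \<open>X\<close> exists; progress counts only where the requirement is not yet met.\<close>
  define \<Phi> where "\<Phi> X = (\<Sum>(R, C)\<in>\<C>. min r (rk R C (elim_block P Q X g)))" for X
  have "\<Phi> X \<le> (\<Sum>(R, C)\<in>\<C>. r)" for X
    unfolding \<Phi>_def by (intro sum_mono) auto
  then have bound: "\<forall>X. (\<forall>p q. X p q \<in> \<int>) \<longrightarrow> \<Phi> X < Suc (\<Sum>(R, C)\<in>\<C>. r)"
    by (auto simp: less_Suc_eq_le)
  obtain X where X: "\<forall>p q. X p q \<in> \<int>"
    and max: "\<And>X'. \<forall>p q. X' p q \<in> \<int> \<Longrightarrow> \<Phi> X' \<le> \<Phi> X"
    using ex_has_greatest_nat[of "\<lambda>X. \<forall>p q. X p q \<in> \<int>" "\<lambda>_ _. 0", OF _ bound] by auto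
  have "r \<le> rk R C (elim_block P Q X g)" if RC: "(R, C) \<in> \<C>" for R C
  proof (rule ccontr)
    assume less: "\<not> ?thesis"
    have finC: "finite C" using fin(4)[OF RC] .
    obtain p q where pq: "p \<in> P" "q \<in> Q" and
      gt: "\<And>t. t \<noteq> 0 \<Longrightarrow> rk R C (elim_block P Q X g)
         < rk R C (\<lambda>e f. elim_block P Q X g e f + t * g e p * g q f)"
      using elim_block_improvable[OF finC fin(1,2), of R X g] less col[OF RC] row[OF RC] by auto
    \<comment> \<open>The amounts that lower the rank for \<open>(R, C)\<close>: at most one for
      each pair, hence finitely many in all, while characteristic 0 supplies infinitely many
      integers.\<close>
    define bad where "bad R C = {t. rk R C (\<lambda>e f. elim_block P Q X g e f + t * g e p * g q f)
      < rk R C (elim_block P Q X g)}" for R C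
    have "finite (bad R C)" if "finite C" for R C
    proof -
      have "bad R C \<subseteq> {t}" if "t \<in> bad R C" for t
        using rk_rank_one_update_drop_unique[OF \<open>finite C\<close>] that unfolding bad_def by fastforce
      then show ?thesis by (metis finite.emptyI finite.insertI finite_subset ex_in_conv)
    qed
    then have "finite (insert 0 (\<Union>(R, C)\<in>\<C>. bad R C))" using fin by auto
    moreover have "infinite (range (of_nat :: nat \<Rightarrow> 'f))"
      by (auto dest!: finite_imageD simp: inj_on_def)
    then have "infinite (\<int> :: 'f set)"
      by (rule infinite_super[rotated]) auto
    ultimately have "\<not> \<int> \<subseteq> insert 0 (\<Union>(R, C)\<in>\<C>. bad R C)" using finite_subset by blast
    then obtain t :: 'f where t: "t \<in> \<int>" "t \<noteq> 0" "\<And>R C. (R, C) \<in> \<C> \<Longrightarrow> t \<notin> bad R C" by blast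
    define X' where "X' = (\<lambda>p' q'. X p' q' + (if p' = p \<and> q' = q then t else 0))"
    have X'g: "elim_block P Q X' g = (\<lambda>e f. elim_block P Q X g e f + t * g e p * g q f)"
      unfolding X'_def by (rule elim_block_single[OF fin(1,2) pq])
    have "\<forall>p q. X' p q \<in> \<int>" using X t(1) by (auto simp: X'_def)
    moreover have "\<Phi> X < \<Phi> X'"
      unfolding \<Phi>_def
    proof (rule sum_strict_mono_ex1[OF fin(3)])
      show "\<forall>x\<in>\<C>. (case x of (R, C) \<Rightarrow> min r (rk R C (elim_block P Q X g)))
          \<le> (case x of (R, C) \<Rightarrow> min r (rk R C (elim_block P Q X' g)))"
        using t(3) by (fastforce simp: bad_def X'g)
      show "\<exists>x\<in>\<C>. (case x of (R, C) \<Rightarrow> min r (rk R C (elim_block P Q X g)))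
          < (case x of (R, C) \<Rightarrow> min r (rk R C (elim_block P Q X' g)))"
        using less gt[OF t(2)] RC by (intro bexI[of _ "(R, C)"]) (auto simp: X'g)
    qed
    ultimately show False using max[of X'] by simp
  qed
  with X show ?thesis by blast
qed

subsection \<open>Elimination of all nodes\<close>

lemma elim_block_Ints:
  fixes g :: "'a \<Rightarrow> 'b \<Rightarrow> 'f::field_char_0"
  assumes "\<And>e f. g e f \<in> \<int>" "\<And>p q. X p q \<in> \<int>"
  shows "elim_block P Q X g e f \<in> \<int>"
  using assms unfolding elim_block_def by (intro Ints_add Ints_sum Ints_mult)

text \<open>\<open>s\<close> holds the ports with prescribed symbols, \<open>\<J>\<close> the port
  sets of the receivers, \<open>\<rho>\<close> witnesses acyclicity, and \<open>M\<close> is the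
  transfer matrix from \<open>s\<close> to the input ports. In the induction step the two positions
  of the eliminated node in a cut yield the two rank hypotheses of the one-node statement.\<close>

lemma node_elimination:
  fixes g :: "'a \<Rightarrow> 'b \<Rightarrow> 'f::field_char_0" and \<rho> :: "'v \<Rightarrow> nat"
  assumes "finite W" "finite s" "finite \<J>" "\<And>J. J \<in> \<J> \<Longrightarrow> finite J"
    and "\<And>v. v \<in> W \<Longrightarrow> finite (Ip v) \<and> finite (Op v)"
    and "\<And>v w. v \<in> W \<Longrightarrow> w \<in> W \<Longrightarrow> v \<noteq> w \<Longrightarrow> Op v \<inter> Op w = {}"
    and "\<And>v. v \<in> W \<Longrightarrow> Op v \<inter> s = {}"
    and "\<And>v w e f. v \<in> W \<Longrightarrow> w \<in> W \<Longrightarrow> e \<in> Op v \<Longrightarrow> f \<in> Ip w \<Longrightarrow> g e f \<noteq> 0 \<Longrightarrow> \<rho> v < \<rho> w"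
    and "\<And>e f. g e f \<in> \<int>"
    and "\<And>J \<Omega>. J \<in> \<J> \<Longrightarrow> \<Omega> \<subseteq> W \<Longrightarrow> r \<le> rk (s \<union> \<Union>(Op ` \<Omega>)) (\<Union>(Ip ` (W - \<Omega>)) \<union> J) g"
  shows "\<exists>\<beta> M. (\<forall>f e. \<beta> f e \<in> \<int>) \<and> (\<forall>e f. M e f \<in> \<int>) \<and> (\<forall>J\<in>\<J>. r \<le> rk s J M) \<and>
    (\<forall>y. \<exists>Yo Yi. (\<forall>e\<in>s. Yo e = y e) \<and>
      (\<forall>v\<in>W. \<forall>e\<in>Op v. Yo e = (\<Sum>f\<in>Ip v. \<beta> f e * Yi f)) \<and>
      (\<forall>f. Yi f = (\<Sum>e\<in>s \<union> \<Union>(Op ` W). g e f * Yo e)) \<and>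
      (\<forall>f. Yi f = (\<Sum>e\<in>s. M e f * y e)))"
  using assms
proof (induction W arbitrary: g rule: finite_induct)
  case empty
  have "r \<le> rk s J g" if "J \<in> \<J>" for J using empty.prems(9)[OF that, of "{}"] by simp
  moreover have "\<exists>Yo Yi. (\<forall>e\<in>s. Yo e = y e) \<and> (\<forall>f. Yi f = (\<Sum>e\<in>s. g e f * Yo e)) \<and>
      (\<forall>f. Yi f = (\<Sum>e\<in>s. g e f * y e))" for y
    by (intro exI[of _ y] exI[of _ "\<lambda>f. \<Sum>e\<in>s. g e f * y e"]) simp
  ultimately show ?case using empty.prems(8)
    by (intro exI[of _ "\<lambda>_ _. 0"] exI[of _ g]) simp
next
  case (insert v W)
  note fin = insert.prems(1-4) and disj = insert.prems(5,6) and acyc = insert.prems(7)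
    and ints = insert.prems(8) and cut = insert.prems(9)
  \<comment> \<open>One row set and column set for each receiver and each cut of the remaining
    nodes. The node \<open>v\<close> is on neither side; adding it to the near or to the far side
    gives back a cut for \<open>g\<close>.\<close>
  define \<C> where "\<C> = (\<lambda>(J, \<Omega>). (s \<union> \<Union>(Op ` \<Omega>), \<Union>(Ip ` (W - \<Omega>)) \<union> J)) ` (\<J> \<times> Pow W)"
  have "\<exists>X. (\<forall>p q. X p q \<in> \<int>) \<and> (\<forall>(R, C)\<in>\<C>. r \<le> rk R C (elim_block (Ip v) (Op v) X g))"
  proof (rule common_block_exists)
    show "finite (Ip v)" "finite (Op v)" using fin(4) by auto
    show "finite \<C>" using fin(2) insert.hyps(1) by (simp add: \<C>_def)
    fix R C assume "(R, C) \<in> \<C>"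
    then obtain J \<Omega> where J: "J \<in> \<J>" "\<Omega> \<subseteq> W" "R = s \<union> \<Union>(Op ` \<Omega>)" "C = \<Union>(Ip ` (W - \<Omega>)) \<union> J"
      by (auto simp: \<C>_def)
    show "finite C" using J fin insert.hyps(1) by auto
    have "insert v W - \<Omega> = insert v (W - \<Omega>)" using J(2) insert.hyps(2) by auto
    then have "\<Union>(Ip ` (insert v W - \<Omega>)) \<union> J = C \<union> Ip v" by (simp add: J(4)) blast
    then show "r \<le> rk R (C \<union> Ip v) g" using cut[OF J(1), of \<Omega>] J(2,3) by auto
    have "insert v W - insert v \<Omega> = W - \<Omega>" using insert.hyps(2) by auto
    moreover have "s \<union> \<Union>(Op ` insert v \<Omega>) = R \<union> Op v" by (simp add: J(3)) blast
    ultimately show "r \<le> rk (R \<union> Op v) C g" using cut[OF J(1), of "insert v \<Omega>"] J(2,4) by auto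
  qed
  then obtain X where X: "\<And>p q. X p q \<in> \<int>"
    "\<And>R C. (R, C) \<in> \<C> \<Longrightarrow> r \<le> rk R C (elim_block (Ip v) (Op v) X g)" by blast
  define g' where "g' = elim_block (Ip v) (Op v) X g"
  \<comment> \<open>A nonzero entry after elimination comes from a direct entry or from a path
    through \<open>v\<close>; between nodes, both increase \<open>\<rho>\<close>.\<close>
  have g'_nz: "g e f \<noteq> 0 \<or> (\<exists>p\<in>Ip v. \<exists>q\<in>Op v. g e p \<noteq> 0 \<and> g q f \<noteq> 0)" if "g' e f \<noteq> 0" for e f
  proof (rule ccontr)
    assume n: "\<not> ?thesis"
    then have "(\<Sum>p\<in>Ip v. \<Sum>q\<in>Op v. g e p * X p q * g q f) = 0"
      by (intro sum.neutral ballI) auto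
    then show False using that n by (simp add: g'_def elim_block_def)
  qed
  have acyc': "\<rho> u < \<rho> w" if "u \<in> W" "w \<in> W" "e \<in> Op u" "f \<in> Ip w" "g' e f \<noteq> 0" for u w e f
    using g'_nz[OF that(5)]
  proof
    assume "g e f \<noteq> 0"
    then show ?thesis using acyc that by blast
  next
    assume "\<exists>p\<in>Ip v. \<exists>q\<in>Op v. g e p \<noteq> 0 \<and> g q f \<noteq> 0"
    then obtain p q where pq: "p \<in> Ip v" "q \<in> Op v" "g e p \<noteq> 0" "g q f \<noteq> 0" by blast
    have "\<rho> u < \<rho> v" using acyc[OF _ _ that(3) pq(1,3)] that(1) by blast
    also have "\<rho> v < \<rho> w" using acyc[OF _ _ pq(2) that(4) pq(4)] that(2) by blast
    finally show ?thesis .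
  qed
  have cut': "r \<le> rk (s \<union> \<Union>(Op ` \<Omega>)) (\<Union>(Ip ` (W - \<Omega>)) \<union> J) g'" if "J \<in> \<J>" "\<Omega> \<subseteq> W" for J \<Omega>
    unfolding g'_def by (rule X(2)) (use that in \<open>auto simp: \<C>_def\<close>)
  have ints': "g' e f \<in> \<int>" for e f
    unfolding g'_def using elim_block_Ints[OF ints X(1)] .
  have "\<exists>\<beta> M. (\<forall>f e. \<beta> f e \<in> \<int>) \<and> (\<forall>e f. M e f \<in> \<int>) \<and> (\<forall>J\<in>\<J>. r \<le> rk s J M) \<and>
    (\<forall>y. \<exists>Yo Yi. (\<forall>e\<in>s. Yo e = y e) \<and>
      (\<forall>v\<in>W. \<forall>e\<in>Op v. Yo e = (\<Sum>f\<in>Ip v. \<beta> f e * Yi f)) \<and>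
      (\<forall>f. Yi f = (\<Sum>e\<in>s \<union> \<Union>(Op ` W). g' e f * Yo e)) \<and>
      (\<forall>f. Yi f = (\<Sum>e\<in>s. M e f * y e)))"
    by (rule insert.IH[OF fin(1-4) disj acyc' ints' cut']) auto
  then obtain \<beta>' M where \<beta>': "\<And>f e. \<beta>' f e \<in> \<int>" and M: "\<And>e f. M e f \<in> \<int>" "\<And>J. J \<in> \<J> \<Longrightarrow> r \<le> rk s J M"
    and Y: "\<And>y. \<exists>Yo Yi. (\<forall>e\<in>s. Yo e = y e) \<and>
      (\<forall>v\<in>W. \<forall>e\<in>Op v. Yo e = (\<Sum>f\<in>Ip v. \<beta>' f e * Yi f)) \<and>
      (\<forall>f. Yi f = (\<Sum>e\<in>s \<union> \<Union>(Op ` W). g' e f * Yo e)) \<and>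
      (\<forall>f. Yi f = (\<Sum>e\<in>s. M e f * y e))" by blast
  define \<beta> where "\<beta> = (\<lambda>f e. if e \<in> Op v then X f e else \<beta>' f e)"
  have vW: "e \<notin> Op v" if "e \<in> Op w" "w \<in> W" for e w
    using disj(1)[of v w] that insert.hyps(2) by blast
  have vs: "e \<notin> Op v" if "e \<in> s" for e
    using disj(2)[of v] that by blast
  \<comment> \<open>An entry from \<open>v\<close> to itself would need
    \<open>\<rho> v < \<rho> v\<close>. Without it the inputs of \<open>v\<close> do not depend on
    its own outputs, so putting \<open>v\<close> back leaves them unchanged.\<close>
  have no_loop: "g q p = 0" if "q \<in> Op v" "p \<in> Ip v" for p q
    using acyc[OF _ _ that] by blast
  have "\<exists>Yo Yi. (\<forall>e\<in>s. Yo e = y e) \<and>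
      (\<forall>u\<in>insert v W. \<forall>e\<in>Op u. Yo e = (\<Sum>f\<in>Ip u. \<beta> f e * Yi f)) \<and>
      (\<forall>f. Yi f = (\<Sum>e\<in>s \<union> \<Union>(Op ` insert v W). g e f * Yo e)) \<and>
      (\<forall>f. Yi f = (\<Sum>e\<in>s. M e f * y e))" for y
  proof -
    obtain Yo Yi where
      Yo_s: "\<And>e. e \<in> s \<Longrightarrow> Yo e = y e" and
      Yo_W: "\<And>w e. w \<in> W \<Longrightarrow> e \<in> Op w \<Longrightarrow> Yo e = (\<Sum>f\<in>Ip w. \<beta>' f e * Yi f)" and
      Yi: "\<And>f. Yi f = (\<Sum>e\<in>s \<union> \<Union>(Op ` W). g' e f * Yo e)" and
      YiM: "\<And>f. Yi f = (\<Sum>e\<in>s. M e f * y e)" using Y[of y] by blast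
    define S' where "S' = s \<union> \<Union>(Op ` W)"
    define Yo' where "Yo' = (\<lambda>e. if e \<in> Op v then (\<Sum>f\<in>Ip v. X f e * Yi f) else Yo e)"
    have S': "finite S'" "S' \<inter> Op v = {}" "s \<union> \<Union>(Op ` insert v W) = S' \<union> Op v"
      using fin insert.hyps(1) vW vs by (auto simp: S'_def)
    have Yo'_S': "Yo' e = Yo e" if "e \<in> S'" for e
      using that S'(2) by (auto simp: Yo'_def)
    have Yi_v: "Yi p = (\<Sum>e\<in>S'. g e p * Yo e)" if "p \<in> Ip v" for p
      using no_loop that by (simp add: Yi S'_def[symmetric] g'_def elim_block_def)
    have "Yi f = (\<Sum>e\<in>S' \<union> Op v. g e f * Yo' e)" for f
    proof -
      \<comment> \<open>The output symbols of \<open>v\<close> are expanded through its inputs, and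
        the sums are reordered until the entries that elimination added to \<open>g\<close>
        appear.\<close>
      have "(\<Sum>e\<in>Op v. g e f * Yo' e) = (\<Sum>q\<in>Op v. \<Sum>p\<in>Ip v. g q f * (X p q * Yi p))"
        by (intro sum.cong) (auto simp: Yo'_def sum_distrib_left)
      also have "\<dots> = (\<Sum>q\<in>Op v. \<Sum>p\<in>Ip v. \<Sum>e\<in>S'. g e p * X p q * g q f * Yo e)"
        by (intro sum.cong refl) (simp add: Yi_v sum_distrib_left mult_ac)
      also have "\<dots> = (\<Sum>q\<in>Op v. \<Sum>e\<in>S'. \<Sum>p\<in>Ip v. g e p * X p q * g q f * Yo e)"
        by (intro sum.cong refl sum.swap)
      also have "\<dots> = (\<Sum>e\<in>S'. \<Sum>q\<in>Op v. \<Sum>p\<in>Ip v. g e p * X p q * g q f * Yo e)"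
        by (rule sum.swap)
      also have "\<dots> = (\<Sum>e\<in>S'. \<Sum>p\<in>Ip v. \<Sum>q\<in>Op v. g e p * X p q * g q f * Yo e)"
        by (intro sum.cong refl sum.swap)
      finally have "(\<Sum>e\<in>Op v. g e f * Yo' e) = (\<Sum>e\<in>S'. (g' e f - g e f) * Yo e)"
        by (simp add: g'_def elim_block_def sum_distrib_right)
      moreover have "(\<Sum>e\<in>S'. g e f * Yo' e) = (\<Sum>e\<in>S'. g e f * Yo e)"
        using Yo'_S' by simp
      moreover have "(\<Sum>e\<in>S' \<union> Op v. g e f * Yo' e) = (\<Sum>e\<in>S'. g e f * Yo' e) + (\<Sum>e\<in>Op v. g e f * Yo' e)"
        using S' fin(4)[of v] by (intro sum.union_disjoint) auto
      ultimately have "(\<Sum>e\<in>S' \<union> Op v. g e f * Yo' e) = (\<Sum>e\<in>S'. g' e f * Yo e)"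
        by (simp add: algebra_simps sum.distrib[symmetric])
      then show ?thesis by (simp add: Yi S'_def)
    qed
    moreover have "Yo' e = (\<Sum>f\<in>Ip u. \<beta> f e * Yi f)" if "u \<in> insert v W" "e \<in> Op u" for u e
      using that vW Yo_W by (cases "e \<in> Op v") (auto simp: Yo'_def \<beta>_def)
    moreover have "\<forall>e\<in>s. Yo' e = y e" using Yo_s vs by (simp add: Yo'_def)
    ultimately show ?thesis using YiM unfolding S'(3)
      by (intro exI[of _ Yo'] exI[of _ Yi]) blast
  qed
  moreover have "\<forall>f e. \<beta> f e \<in> \<int>" using X(1) \<beta>' by (simp add: \<beta>_def)
  ultimately show ?case using M by (intro exI[of _ \<beta>] exI[of _ M]) blast
qed

subsection \<open>The rank of a cut matrix\<close>

context vec_space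
begin

text \<open>Each vector of \<open>X\<close> serves as its own column index, which makes a set of
  vectors an indexed family.\<close>

lemma lin_indpt_iff_indep_cols:
  assumes "finite X" "X \<subseteq> carrier_vec n"
  shows "lin_indpt X \<longleftrightarrow> indep_cols {..<n} X (\<lambda>i x. x $ i)"
proof
  assume li: "lin_indpt X"
  show "indep_cols {..<n} X (\<lambda>i x. x $ i)"
    unfolding indep_cols_def
  proof (intro allI impI ballI, rule ccontr)
    fix c x assume c: "\<forall>i\<in>{..<n}. (\<Sum>x\<in>X. c x * x $ i) = 0" and x: "x \<in> X" "c x \<noteq> 0"
    have "lincomb c X = 0\<^sub>v n"
      using c assms by (intro eq_vecI) (auto simp: lincomb_index lincomb_dim)
    then have "lin_dep X"
      using lin_dep_crit[OF assms(1) subset_refl _ x(1), of c] x(2) by auto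
    then show False using li by blast
  qed
next
  assume ic: "indep_cols {..<n} X (\<lambda>i x. x $ i)"
  show "lin_indpt X"
  proof (rule ccontr)
    assume "\<not> lin_indpt X"
    then obtain c x where c: "lincomb c X = 0\<^sub>v n" "x \<in> X" "c x \<noteq> 0"
      using finite_lin_dep[OF assms(1)] assms(2) by auto
    have "(\<Sum>x\<in>X. c x * x $ i) = 0" if "i < n" for i
      using lincomb_index[OF that assms(2), of c] c(1) that by simp
    then have "\<forall>x\<in>X. c x = 0" using ic unfolding indep_cols_def by blast
    then show False using c by blast
  qed
qed

lemma rank_eq_rk:
  assumes A: "A \<in> carrier_mat n nc"
  shows "rank A = rk {..<n} (set (cols A)) (\<lambda>i x. x $ i)"
proof (rule antisym)
  have carr: "set (cols A) \<subseteq> carrier_vec n" using A cols_dim[of A] by simp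
  obtain U where U: "maximal U (\<lambda>T. T \<subseteq> set (cols A) \<and> lin_indpt T)"
    using maximal_exists[of "\<lambda>T. T \<subseteq> set (cols A) \<and> lin_indpt T" "card (set (cols A))" "{}"]
    by (meson List.finite_set card_mono empty_iff empty_subsetI finite_lin_indpt2 rev_finite_subset)
  then have "U \<subseteq> set (cols A)" "lin_indpt U" unfolding maximal_def by auto
  then have "indep_cols {..<n} U (\<lambda>i x. x $ i)"
    using lin_indpt_iff_indep_cols[of U] carr finite_subset[of U "set (cols A)"] by auto
  then show "rank A \<le> rk {..<n} (set (cols A)) (\<lambda>i x. x $ i)"
    unfolding rank_card_indpt[OF A U] using \<open>U \<subseteq> set (cols A)\<close> by (intro card_le_rk) auto
  obtain J where J: "J \<subseteq> set (cols A)" "indep_cols {..<n} J (\<lambda>i x. x $ i)"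
    "card J = rk {..<n} (set (cols A)) (\<lambda>i x. x $ i)" "finite J"
    by (rule rk_basis_exists[of "set (cols A)" "{..<n}" "\<lambda>i x. x $ i"]) simp
  then have "lin_indpt J" using lin_indpt_iff_indep_cols[of J] carr by auto
  then show "rk {..<n} (set (cols A)) (\<lambda>i x. x $ i) \<le> rank A"
    using rank_ge_card_indpt[OF A J(1)] J(3) by simp
qed

end

definition adjacency :: "('p \<times> 'p) set \<Rightarrow> 'p \<Rightarrow> 'p \<Rightarrow> 'f::field" where
  "adjacency E e f = (if (e, f) \<in> E then 1 else 0)"

text \<open>\<open>rank\<close> works with the set of distinct column vectors and with list
  positions of rows, whereas \<open>rk\<close> is indexed by ports and tells equal columns apart.
  Each of the two column families spans the other, so repeated columns do not matter.\<close>

lemma mat_rank_cut_matrix: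
  assumes "finite (\<Union>v\<in>\<Omega>. Op v)" "finite (\<Union>w\<in>V - \<Omega>. Ip w)"
  shows "mat_rank (cut_matrix V Ip Op E \<Omega>)
    = rk (\<Union>v\<in>\<Omega>. Op v) (\<Union>w\<in>V - \<Omega>. Ip w) (adjacency E :: _ \<Rightarrow> _ \<Rightarrow> rat)"
proof -
  define R where "R = (\<Union>v\<in>\<Omega>. Op v)"
  define C where "C = (\<Union>w\<in>V - \<Omega>. Ip w)"
  define rs where "rs = sorted_list_of_set R"
  define cs where "cs = sorted_list_of_set C"
  define n where "n = length rs"
  define A where "A = cut_matrix V Ip Op E \<Omega>"
  define G :: "nat \<Rightarrow> _ \<Rightarrow> rat" where "G = (\<lambda>i. adjacency E (rs ! i))"
  define h where "h = (\<lambda>f. vec n (\<lambda>i. G i f))"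
  have sets: "set rs = R" "set cs = C" "finite C"
    using assms by (auto simp: rs_def cs_def R_def C_def)
  have A: "A = mat n (length cs) (\<lambda>(i, j). G i (cs ! j))"
    unfolding A_def cut_matrix_def n_def G_def adjacency_def rs_def cs_def R_def C_def Let_def by simp
  then have carr: "A \<in> carrier_mat n (length cs)" by simp
  have "cols A = map h cs"
    by (rule nth_equalityI) (auto simp: A h_def intro!: eq_vecI)
  then have cols: "set (cols A) = h ` C" using sets by simp
  interpret vec_space "TYPE(rat)" n .
  have "mat_rank A = rk {..<n} (h ` C) (\<lambda>i x. x $ i)"
    using rank_eq_rk[OF carr] carr unfolding mat_rank_def cols by simp
  also have "\<dots> = rk {..<n} C G"
  proof (rule antisym)
    obtain J where J: "J \<subseteq> h ` C" "indep_cols {..<n} J (\<lambda>i x. x $ i)"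
      "card J = rk {..<n} (h ` C) (\<lambda>i x. x $ i)" "finite J"
      by (rule rk_basis_exists[of "h ` C" "{..<n}" "\<lambda>i x. x $ i"]) (use sets in simp)
    have "col_in_span {..<n} C G (\<lambda>i. x $ i)" if x: "x \<in> J" for x
    proof -
      obtain f where f: "f \<in> C" "x = h f" using J(1) x by blast
      show ?thesis using col_in_span_member[OF f(1) sets(3), of "{..<n}" G]
        by (simp add: f(2) h_def col_in_span_def)
    qed
    then show "rk {..<n} (h ` C) (\<lambda>i x. x $ i) \<le> rk {..<n} C G"
      unfolding J(3)[symmetric] using J by (intro card_le_rk_if_spanned[OF sets(3)]) auto
  next
    obtain J where J: "J \<subseteq> C" "indep_cols {..<n} J G" "card J = rk {..<n} C G" "finite J"
      by (rule rk_basis_exists[OF sets(3)])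
    have "col_in_span {..<n} (h ` C) (\<lambda>i x. x $ i) (\<lambda>i. G i f)" if "f \<in> J" for f
    proof -
      have "h f \<in> h ` C" using J(1) that by blast
      from col_in_span_member[OF this, of "{..<n}" "\<lambda>i x. x $ i"] sets(3)
      show ?thesis by (simp add: h_def col_in_span_def)
    qed
    then show "rk {..<n} C G \<le> rk {..<n} (h ` C) (\<lambda>i x. x $ i)"
      unfolding J(3)[symmetric] using J sets(3) by (intro card_le_rk_if_spanned) auto
  qed
  also have "\<dots> = rk R C (adjacency E :: _ \<Rightarrow> _ \<Rightarrow> rat)"
  proof -
    have "indep_cols {..<n} J G \<longleftrightarrow> indep_cols R J (adjacency E :: _ \<Rightarrow> _ \<Rightarrow> rat)" for J
      unfolding indep_cols_def G_def sets(1)[symmetric] n_def all_set_conv_all_nth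
      by (simp add: lessThan_def)
    then show ?thesis by (simp add: rk_def)
  qed
  finally show ?thesis by (simp add: A_def R_def C_def)
qed

subsection \<open>Prime fields on the natural numbers\<close>

text \<open>Residues are represented by natural numbers because \<open>solvable\<close> quantifies
  over a \<open>nat ring\<close>.\<close>

definition prime_field :: "nat \<Rightarrow> nat ring" where
  "prime_field p = \<lparr>carrier = {..<p}, monoid.mult = (\<lambda>a b. a * b mod p), one = 1, zero = 0,
     add = (\<lambda>a b. (a + b) mod p)\<rparr>"

text \<open>The reduction homomorphism from the integers. As it is onto the carrier, the ring axioms
  of the prime field are inherited from \<open>int\<close>, and integral code equations transfer to
  the field.\<close>

definition residue_of :: "nat \<Rightarrow> int \<Rightarrow> nat" where
  "residue_of p a = nat (a mod int p)"

context
  fixes p :: nat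
  assumes p: "prime p"
begin

lemma modulus_pos: "p > 1" "int p > 0" using prime_gt_1_nat[OF p] by auto

lemma int_residue_of: "int (residue_of p a) = a mod int p"
  using modulus_pos by (simp add: residue_of_def)

lemma residue_of_eqI: "x < p \<Longrightarrow> int x = a mod int p \<Longrightarrow> residue_of p a = x"
  using int_residue_of[of a] by simp

lemma residue_of_in_carrier: "residue_of p a \<in> carrier (prime_field p)"
  using modulus_pos by (simp add: residue_of_def prime_field_def nat_less_iff)

lemma residue_of_surj: "x \<in> carrier (prime_field p) \<Longrightarrow> residue_of p (int x) = x"
  by (simp add: prime_field_def residue_of_def)

lemma residue_of_mult:
  "residue_of p a \<otimes>\<^bsub>prime_field p\<^esub> residue_of p b = residue_of p (a * b)"
  using modulus_pos by (intro residue_of_eqI[symmetric])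
    (simp_all add: prime_field_def zmod_int int_residue_of mod_mult_eq)

lemma residue_of_add:
  "residue_of p a \<oplus>\<^bsub>prime_field p\<^esub> residue_of p b = residue_of p (a + b)"
  using modulus_pos by (intro residue_of_eqI[symmetric])
    (simp_all add: prime_field_def zmod_int int_residue_of mod_add_eq)

lemma residue_of_zero: "\<zero>\<^bsub>prime_field p\<^esub> = residue_of p 0"
  by (simp add: prime_field_def residue_of_def)

lemma residue_of_one: "\<one>\<^bsub>prime_field p\<^esub> = residue_of p 1"
  using modulus_pos by (simp add: prime_field_def residue_of_def)

lemma residue_of_eq_iff: "residue_of p a = residue_of p b \<longleftrightarrow> a mod int p = b mod int p"
  using int_residue_of by (metis of_nat_eq_iff)

lemma residue_of_inverse:
  assumes "\<not> int p dvd a"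
  obtains b where "residue_of p (a * b) = residue_of p 1"
proof -
  have "prime (int p)" using p by simp
  then have "coprime a (int p)" using assms prime_imp_coprime coprime_commute by blast
  then obtain u v where "u * a + v * int p = 1"
    using bezout_int[of a "int p"] by (auto simp: coprime_iff_gcd_eq_1)
  then have "a * u = 1 + (- v) * int p" by (simp add: algebra_simps)
  then have "(a * u) mod int p = 1 mod int p" by (simp only: mod_mult_self1)
  then show ?thesis using that residue_of_eq_iff by blast
qed

lemma prime_field_is_field: "field (prime_field p)"
proof -
  let ?F = "prime_field p"
  have "cring ?F"
  proof (rule cringI)
    show "abelian_group ?F"
    proof (rule abelian_groupI)
      fix x y z
      assume "x \<in> carrier ?F" "y \<in> carrier ?F" "z \<in> carrier ?F"
      then obtain a b c where "x = residue_of p a" "y = residue_of p b" "z = residue_of p c"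
        using residue_of_surj by metis
      then show "x \<oplus>\<^bsub>?F\<^esub> y \<oplus>\<^bsub>?F\<^esub> z = x \<oplus>\<^bsub>?F\<^esub> (y \<oplus>\<^bsub>?F\<^esub> z)"
        by (simp add: residue_of_add add.assoc)
    next
      fix x y assume "x \<in> carrier ?F" "y \<in> carrier ?F"
      then obtain a b where ab: "x = residue_of p a" "y = residue_of p b"
        using residue_of_surj by metis
      show "x \<oplus>\<^bsub>?F\<^esub> y \<in> carrier ?F" unfolding ab residue_of_add by (rule residue_of_in_carrier)
      show "x \<oplus>\<^bsub>?F\<^esub> y = y \<oplus>\<^bsub>?F\<^esub> x" unfolding ab residue_of_add by (simp add: add.commute)
    next
      fix x assume "x \<in> carrier ?F"
      then obtain a where a: "x = residue_of p a" using residue_of_surj by metis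
      show "\<zero>\<^bsub>?F\<^esub> \<oplus>\<^bsub>?F\<^esub> x = x" by (simp add: a residue_of_zero residue_of_add)
      show "\<exists>y\<in>carrier ?F. y \<oplus>\<^bsub>?F\<^esub> x = \<zero>\<^bsub>?F\<^esub>"
        by (rule bexI[of _ "residue_of p (- a)"]) (simp_all add: a residue_of_zero residue_of_add residue_of_in_carrier)
    qed (simp add: residue_of_zero residue_of_in_carrier)
    show "comm_monoid ?F"
    proof (rule comm_monoidI)
      fix x y z
      assume "x \<in> carrier ?F" "y \<in> carrier ?F" "z \<in> carrier ?F"
      then obtain a b c where "x = residue_of p a" "y = residue_of p b" "z = residue_of p c"
        using residue_of_surj by metis
      then show "x \<otimes>\<^bsub>?F\<^esub> y \<otimes>\<^bsub>?F\<^esub> z = x \<otimes>\<^bsub>?F\<^esub> (y \<otimes>\<^bsub>?F\<^esub> z)"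
        by (simp add: residue_of_mult mult.assoc)
    next
      fix x y assume "x \<in> carrier ?F" "y \<in> carrier ?F"
      then obtain a b where ab: "x = residue_of p a" "y = residue_of p b"
        using residue_of_surj by metis
      show "x \<otimes>\<^bsub>?F\<^esub> y \<in> carrier ?F" unfolding ab residue_of_mult by (rule residue_of_in_carrier)
      show "x \<otimes>\<^bsub>?F\<^esub> y = y \<otimes>\<^bsub>?F\<^esub> x" unfolding ab residue_of_mult by (simp add: mult.commute)
    next
      fix x assume "x \<in> carrier ?F"
      then obtain a where a: "x = residue_of p a" using residue_of_surj by metis
      show "\<one>\<^bsub>?F\<^esub> \<otimes>\<^bsub>?F\<^esub> x = x" by (simp add: a residue_of_one residue_of_mult)
    qed (simp add: residue_of_one residue_of_in_carrier)
    fix x y z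
    assume "x \<in> carrier ?F" "y \<in> carrier ?F" "z \<in> carrier ?F"
    then obtain a b c where "x = residue_of p a" "y = residue_of p b" "z = residue_of p c"
      using residue_of_surj by metis
    then show "(x \<oplus>\<^bsub>?F\<^esub> y) \<otimes>\<^bsub>?F\<^esub> z = x \<otimes>\<^bsub>?F\<^esub> z \<oplus>\<^bsub>?F\<^esub> y \<otimes>\<^bsub>?F\<^esub> z"
      by (simp add: residue_of_add residue_of_mult distrib_right)
  qed
  then interpret cring ?F .
  show ?thesis
  proof (rule cring_fieldI2)
    show "\<zero>\<^bsub>?F\<^esub> \<noteq> \<one>\<^bsub>?F\<^esub>" by (simp add: prime_field_def)
    fix x assume x: "x \<in> carrier ?F" "x \<noteq> \<zero>\<^bsub>?F\<^esub>"
    then have "\<not> int p dvd int x" by (auto simp: prime_field_def dest: dvd_imp_le)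
    then obtain b where b: "residue_of p (int x * b) = residue_of p 1" by (rule residue_of_inverse)
    have "x \<otimes>\<^bsub>?F\<^esub> residue_of p b = \<one>\<^bsub>?F\<^esub>"
      using b residue_of_mult[of "int x" b] residue_of_surj[OF x(1)] by (simp add: residue_of_one)
    then show "\<exists>y\<in>carrier ?F. x \<otimes>\<^bsub>?F\<^esub> y = \<one>\<^bsub>?F\<^esub>" using residue_of_in_carrier by blast
  qed
qed

lemma residue_of_sum:
  "finite A \<Longrightarrow> (\<Oplus>\<^bsub>prime_field p\<^esub>a\<in>A. residue_of p (f a)) = residue_of p (\<Sum>a\<in>A. f a)"
proof (induction A rule: finite_induct)
  case empty
  interpret field "prime_field p" by (rule prime_field_is_field)
  show ?case by (simp add: residue_of_zero)
next
  case (insert x A)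
  interpret field "prime_field p" by (rule prime_field_is_field)
  show ?case using insert by (simp add: residue_of_in_carrier residue_of_add)
qed

end

subsection \<open>Scaled inverses\<close>

text \<open>Serves to relabel virtual ports as processes: independent columns pull back along the
  injection \<open>b\<close>.\<close>

lemma rk_image_le:
  assumes "inj_on b C" "finite C"
  shows "rk (a ` R) (b ` C) g \<le> rk R C (\<lambda>e f. g (a e) (b f))"
proof -
  obtain J where J: "J \<subseteq> b ` C" "indep_cols (a ` R) J g" "card J = rk (a ` R) (b ` C) g"
    by (rule rk_basis_exists[of "b ` C" "a ` R" g]) (use assms in auto)
  obtain J' where J': "J' \<subseteq> C" "J = b ` J'" using J(1) by (auto simp: subset_image_iff)
  have inj: "inj_on b J'" using assms(1) J'(1) by (rule inj_on_subset)
  have "indep_cols R J' (\<lambda>e f. g (a e) (b f))"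
    unfolding indep_cols_def
  proof (intro allI impI)
    fix c assume c: "\<forall>e\<in>R. (\<Sum>f\<in>J'. c f * g (a e) (b f)) = 0"
    define d where "d = (\<lambda>x. c (the_inv_into J' b x))"
    have d: "d (b f) = c f" if "f \<in> J'" for f
      using that inj by (simp add: d_def the_inv_into_f_f)
    have "(\<Sum>x\<in>J. d x * g (a e) x) = (\<Sum>f\<in>J'. c f * g (a e) (b f))" for e
      by (simp add: J'(2) sum.reindex[OF inj] d)
    then have "\<forall>e\<in>a ` R. (\<Sum>x\<in>J. d x * g e x) = 0" using c by simp
    then have "\<forall>x\<in>J. d x = 0" using J(2) unfolding indep_cols_def by blast
    then show "\<forall>f\<in>J'. c f = 0" using d J'(2) by auto
  qed
  then have "card J' \<le> rk R C (\<lambda>e f. g (a e) (b f))"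
    using card_le_rk[OF assms(2) J'(1)] by blast
  then show ?thesis using J(3) by (simp add: J'(2) card_image[OF inj])
qed

text \<open>Otherwise the unit column and a basis of at least \<open>card s\<close> columns would be
  more than \<open>card s\<close> independent columns in a space spanned by \<open>card s\<close>
  unit columns.\<close>

lemma unit_in_span_of_full_rank:
  fixes M :: "'a \<Rightarrow> 'b \<Rightarrow> 'f::field"
  assumes "finite s" "finite J" "card s \<le> rk s J M" "k \<in> s"
  shows "col_in_span s J M (\<lambda>l. if l = k then 1 else 0)"
proof (rule ccontr)
  assume n: "\<not> ?thesis"
  obtain J0 where J0: "J0 \<subseteq> J" "indep_cols s J0 M" "card J0 = rk s J M" "finite J0"
    by (rule rk_basis_exists[OF assms(2)])
  let ?h = "\<lambda>l i. case i of None \<Rightarrow> (if l = k then 1 else 0) | Some f \<Rightarrow> M l f"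
  have "\<not> col_in_span s J0 M (\<lambda>l. if l = k then 1 else 0)"
    using n col_in_span_superset[OF _ J0(1) assms(2)] by blast
  then have "indep_cols s (insert None (Some ` J0)) ?h"
    by (rule indep_cols_option_insert[OF J0(4,2)])
  moreover have "col_in_span s s (\<lambda>l k. if l = k then 1 else 0) (\<lambda>l. h l)" for h :: "'a \<Rightarrow> 'f"
    using assms(1) unfolding col_in_span_def
    by (intro exI[of _ h]) (simp add: if_distrib[of "\<lambda>x. _ * x"] cong: if_cong)
  ultimately have "card (insert None (Some ` J0)) \<le> card s"
    using assms(1) J0(4) by (intro card_le_if_spanned) auto
  then show False using J0(3,4) assms(3) by (simp add: card_image)
qed

lemma common_denominator:
  assumes "finite A"
  shows "\<exists>d::int. d \<noteq> 0 \<and> (\<forall>x\<in>A. of_int d * (x::rat) \<in> \<int>)"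
  using assms
proof (induction A rule: finite_induct)
  case empty
  then show ?case by (intro exI[of _ 1]) simp
next
  case (insert x A)
  then obtain d :: int where d: "d \<noteq> 0" "\<And>y. y \<in> A \<Longrightarrow> of_int d * y \<in> \<int>" by blast
  obtain a b where ab: "quotient_of x = (a, b)" by fastforce
  then have b: "b > 0" "x = of_int a / of_int b"
    using quotient_of_denom_pos quotient_of_div by auto
  have "of_int (d * b) * y \<in> \<int>" if "y \<in> insert x A" for y
  proof (cases "y = x")
    case True
    then have "of_int (d * b) * y = of_int (d * a)" using b by simp
    then show ?thesis by (metis Ints_of_int)
  next
    case False
    then have "of_int d * y \<in> \<int>" using d(2)[of y] that by blast
    then have "of_int b * (of_int d * y) \<in> \<int>" by (rule Ints_mult[OF Ints_of_int])
    then show ?thesis by (simp add: mult_ac)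
  qed
  then show ?case using d(1) b(1) by (intro exI[of _ "d * b"]) auto
qed

text \<open>Full row rank gives a rational right inverse; one common denominator makes it integral,
  with the same factor for every \<open>k\<close>.\<close>

lemma scaled_right_inverse:
  fixes M :: "'a \<Rightarrow> 'b \<Rightarrow> int"
  assumes "finite s" "finite J" "card s \<le> rk s J (\<lambda>l f. rat_of_int (M l f))"
  shows "\<exists>c \<epsilon>. c \<noteq> 0 \<and> (\<forall>k\<in>s. \<forall>l\<in>s. (\<Sum>f\<in>J. \<epsilon> f k * M l f) = (if l = k then c else 0))"
proof -
  have "\<forall>k\<in>s. \<exists>a. \<forall>l\<in>s. (if l = k then 1 else 0) = (\<Sum>f\<in>J. a f * rat_of_int (M l f))"
    using unit_in_span_of_full_rank[OF assms] unfolding col_in_span_def by simp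
  from bchoice[OF this] obtain a where
    a: "\<And>k l. k \<in> s \<Longrightarrow> l \<in> s \<Longrightarrow> (if l = k then 1 else 0) = (\<Sum>f\<in>J. a k f * rat_of_int (M l f))"
    by blast
  obtain d :: int where d: "d \<noteq> 0" "\<And>k f. k \<in> s \<Longrightarrow> f \<in> J \<Longrightarrow> of_int d * a k f \<in> \<int>"
    using common_denominator[of "(\<lambda>(k, f). a k f) ` (s \<times> J)"] assms(1,2) by auto
  define \<epsilon> where "\<epsilon> = (\<lambda>f k. \<lfloor>of_int d * a k f\<rfloor>)"
  have \<epsilon>: "rat_of_int (\<epsilon> f k) = of_int d * a k f" if "k \<in> s" "f \<in> J" for k f
    using d(2)[OF that] by (simp add: \<epsilon>_def)
  have "(\<Sum>f\<in>J. \<epsilon> f k * M l f) = (if l = k then d else 0)" if kl: "k \<in> s" "l \<in> s" for k l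
  proof -
    have "rat_of_int (\<Sum>f\<in>J. \<epsilon> f k * M l f) = (\<Sum>f\<in>J. of_int d * (a k f * of_int (M l f)))"
      using \<epsilon>[OF kl(1)] by (simp add: mult.assoc)
    also have "\<dots> = of_int d * (if l = k then 1 else 0)"
      by (simp add: a[OF kl] sum_distrib_left)
    also have "\<dots> = rat_of_int (if l = k then d else 0)" by simp
    finally show ?thesis by (simp only: of_int_eq_iff)
  qed
  then show ?thesis using d(1) by blast
qed

text \<open>For a square matrix of full rank a right inverse is also a left inverse: if
  \<open>M \<epsilon> = c I\<close>, then \<open>M\<close> annihilates
  \<open>\<epsilon> M - c I\<close>, and the columns of \<open>M\<close> are independent.\<close>

lemma scaled_left_inverse:
  fixes M :: "'a \<Rightarrow> 'b \<Rightarrow> int"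
  assumes "finite s" "finite J" "card J \<le> card s" "card s \<le> rk s J (\<lambda>l f. rat_of_int (M l f))"
  shows "\<exists>c P. c \<noteq> 0 \<and> (\<forall>f\<in>J. \<forall>h\<in>J. (\<Sum>l\<in>s. M l f * P l h) = (if f = h then c else 0))"
proof -
  obtain c \<epsilon> where c: "c \<noteq> 0" and
    \<epsilon>: "\<And>k l. k \<in> s \<Longrightarrow> l \<in> s \<Longrightarrow> (\<Sum>f\<in>J. \<epsilon> f k * M l f) = (if l = k then c else 0)"
    using scaled_right_inverse[OF assms(1,2,4)] by blast
  obtain J0 where J0: "J0 \<subseteq> J" "indep_cols s J0 (\<lambda>l f. rat_of_int (M l f))"
    "card J0 = rk s J (\<lambda>l f. rat_of_int (M l f))"
    by (rule rk_basis_exists[OF assms(2)])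
  then have "J0 = J" using assms(3,4) by (intro card_seteq[OF assms(2)]) auto
  then have indep: "indep_cols s J (\<lambda>l f. rat_of_int (M l f))" using J0(2) by simp
  have "(\<Sum>k\<in>s. M k h * \<epsilon> f k) = (if h = f then c else 0)" if h: "h \<in> J" and "f \<in> J" for f h
  proof -
    \<comment> \<open>Column \<open>h\<close> of \<open>\<epsilon> M - c I\<close>.\<close>
    define z where "z f = (\<Sum>k\<in>s. \<epsilon> f k * M k h) - (if f = h then c else 0)" for f
    have "(\<Sum>f\<in>J. z f * M l f) = 0" if l: "l \<in> s" for l
    proof -
      have "(\<Sum>f\<in>J. (\<Sum>k\<in>s. \<epsilon> f k * M k h) * M l f) = (\<Sum>k\<in>s. (\<Sum>f\<in>J. \<epsilon> f k * M l f) * M k h)"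
        unfolding sum_distrib_right by (subst sum.swap) (simp add: mult_ac)
      also have "\<dots> = (\<Sum>k\<in>s. if k = l then c * M l h else 0)"
        using \<epsilon> l by (intro sum.cong) auto
      also have "\<dots> = c * M l h" using l assms(1) by simp
      finally have "(\<Sum>f\<in>J. (\<Sum>k\<in>s. \<epsilon> f k * M k h) * M l f) = c * M l h" .
      moreover have "(\<Sum>f\<in>J. (if f = h then c else 0) * M l f) = c * M l h"
        using h assms(2) by (simp add: if_distrib[of "\<lambda>x. x * _"] cong: if_cong)
      ultimately show ?thesis by (simp add: z_def left_diff_distrib sum_subtractf)
    qed
    then have "(\<Sum>f\<in>J. rat_of_int (z f) * rat_of_int (M l f)) = 0" if "l \<in> s" for l
      using that by (simp flip: of_int_mult of_int_sum)
    then have "\<forall>f\<in>J. rat_of_int (z f) = 0"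
      using spec[OF indep[unfolded indep_cols_def], of "\<lambda>f. rat_of_int (z f)"] by blast
    then have "z f = 0" using \<open>f \<in> J\<close> by simp
    then show ?thesis by (auto simp: z_def mult.commute)
  qed
  then show ?thesis using c by (intro exI[of _ c] exI[of _ "\<lambda>l h. \<epsilon> h l"]) auto
qed

subsection \<open>Integral codes\<close>

text \<open>\<open>Src x\<close> is a virtual output port carrying the process \<open>x\<close>, wired to a virtual input port of the
  source; \<open>Snk x\<close> is a virtual output port at the owner of \<open>x\<close>, wired to an input port of a
  super-destination.\<close>

datatype ('p, 'k) ext_port = Port 'p | Src 'k | Snk 'k

fun ext_adjacency :: "('p \<times> 'p) set \<Rightarrow> ('p, 'k) ext_port \<Rightarrow> ('p, 'k) ext_port \<Rightarrow> 'f::field" where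
  "ext_adjacency E (Port e) (Port f) = adjacency E e f"
| "ext_adjacency E (Src x) (Src y) = (if x = y then 1 else 0)"
| "ext_adjacency E (Snk x) (Snk y) = (if x = y then 1 else 0)"
| "ext_adjacency E _ _ = 0"

text \<open>The extended matrix is block diagonal, so independent columns of the network block and
  the identity block on the sink ports in \<open>D\<close> add up.\<close>

lemma card_le_rk_ext_adjacency:
  assumes J: "finite J" "indep_cols R0 J (adjacency E :: _ \<Rightarrow> _ \<Rightarrow> 'f::field)" and D: "finite D"
    and R: "Port ` R0 \<union> Snk ` D \<subseteq> R" and C: "Port ` J \<union> Snk ` D \<subseteq> C" "finite C"
  shows "card J + card D \<le> rk R C (ext_adjacency E :: _ \<Rightarrow> _ \<Rightarrow> 'f)"
proof -
  have sum: "(\<Sum>i\<in>Port ` J \<union> Snk ` D. h i) = (\<Sum>f\<in>J. h (Port f)) + (\<Sum>x\<in>D. h (Snk x))"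
    for h :: "_ \<Rightarrow> 'f"
    using J(1) D by (subst sum.union_disjoint) (auto simp: sum.reindex inj_on_def)
  have "indep_cols R (Port ` J \<union> Snk ` D) (ext_adjacency E :: _ \<Rightarrow> _ \<Rightarrow> 'f)"
    unfolding indep_cols_def
  proof (intro allI impI)
    fix c :: "_ \<Rightarrow> 'f"
    assume c: "\<forall>e\<in>R. (\<Sum>f\<in>Port ` J \<union> Snk ` D. c f * ext_adjacency E e f) = 0"
    have "c (Snk x) = 0" if x: "x \<in> D" for x
    proof -
      have "(\<Sum>y\<in>D. c (Snk y) * (if x = y then 1 else 0)) = c (Snk x)"
        using x D by (simp add: if_distrib[of "\<lambda>z. _ * z"] cong: if_cong)
      moreover have "Snk x \<in> R" using R x by blast
      ultimately show ?thesis using bspec[OF c, of "Snk x"] by (simp add: sum)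
    qed
    moreover have "\<forall>e\<in>R0. (\<Sum>f\<in>J. c (Port f) * adjacency E e f) = 0"
    proof
      fix e assume "e \<in> R0"
      then have "Port e \<in> R" using R by blast
      then show "(\<Sum>f\<in>J. c (Port f) * adjacency E e f) = 0"
        using bspec[OF c, of "Port e"] by (simp add: sum)
    qed
    then have "\<forall>f\<in>J. c (Port f) = 0"
      using spec[OF J(2)[unfolded indep_cols_def], of "\<lambda>f. c (Port f)"] by blast
    ultimately show "\<forall>f\<in>Port ` J \<union> Snk ` D. c f = 0" by auto
  qed
  from card_le_rk[OF C(2,1) this]
  have "card (Port ` J \<union> Snk ` D) \<le> rk R C (ext_adjacency E :: _ \<Rightarrow> _ \<Rightarrow> 'f)" .
  moreover have "card (Port ` J \<union> Snk ` D) = card J + card D"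
    using J(1) D by (subst card_Un_disjoint) (auto simp: card_image inj_on_def)
  ultimately show ?thesis by simp
qed

text \<open>Serves the cuts with the source on the far side: the virtual wires into the source alone
  carry all processes across.\<close>

lemma card_sources_le_rk_ext_adjacency:
  fixes R C :: "('p, 'k) ext_port set"
  assumes "finite X" "Src ` X \<subseteq> R" "Src ` X \<subseteq> C" "finite C"
  shows "card X \<le> rk R C (ext_adjacency E :: _ \<Rightarrow> _ \<Rightarrow> 'f::field)"
proof -
  have "indep_cols R (Src ` X) (ext_adjacency E :: _ \<Rightarrow> _ \<Rightarrow> 'f)"
    unfolding indep_cols_def
  proof (intro allI impI ballI)
    fix c :: "('p, 'k) ext_port \<Rightarrow> 'f" and f :: "('p, 'k) ext_port"
    assume c: "\<forall>e\<in>R. (\<Sum>f\<in>Src ` X. c f * ext_adjacency E e f) = 0" and "f \<in> Src ` X"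
    then obtain x where x: "x \<in> X" "f = Src x" by blast
    have "(\<Sum>f\<in>Src ` X. c f * ext_adjacency E (Src x) f) = (\<Sum>y\<in>X. c (Src y) * (if x = y then 1 else 0))"
      by (subst sum.reindex) (auto simp: inj_on_def)
    also have "\<dots> = c (Src x)"
      using x(1) assms(1) by (simp add: if_distrib[of "\<lambda>z. _ * z"] cong: if_cong)
    finally show "c f = 0" using bspec[OF c, of "Src x"] x assms(2) by auto
  qed
  then have "card (Src ` X :: ('p, 'k) ext_port set) \<le> rk R C (ext_adjacency E :: _ \<Rightarrow> _ \<Rightarrow> 'f)"
    by (rule card_le_rk[OF assms(4,3)])
  then show ?thesis by (simp add: card_image inj_on_def)
qed

section \<open>Ports, depth and integral codes in an acyclic network\<close>

locale acyclic_adt =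
  fixes V :: "'v set" and Ip Op :: "'v \<Rightarrow> 'p set" and E :: "('p \<times> 'p) set"
  assumes net: "acyclic_adt_network V Ip Op E"
begin

lemma adt: "adt_network V Ip Op E"
  using net by (simp add: acyclic_adt_network_def)

lemma finite_nodes: "finite V"
  using adt by (simp add: adt_network_def)

lemma finite_ports:
  assumes "v \<in> V"
  shows "finite (Ip v)" "finite (Op v)"
  using adt assms by (simp_all add: adt_network_def)

lemma in_out_disjoint: "v \<in> V \<Longrightarrow> w \<in> V \<Longrightarrow> Ip v \<inter> Op w = {}"
  using adt by (simp add: adt_network_def)

lemma ports_disjoint:
  assumes "v \<in> V" "w \<in> V" "v \<noteq> w"
  shows "Ip v \<inter> Ip w = {}" "Op v \<inter> Op w = {}"
  using adt assms by (simp_all add: adt_network_def)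

lemma edge_ports:
  assumes "(e, f) \<in> E"
  shows "\<exists>v\<in>V. \<exists>w\<in>V. v \<noteq> w \<and> e \<in> Op v \<and> f \<in> Ip w"
proof -
  have "\<forall>(e, f)\<in>E. \<exists>v\<in>V. \<exists>w\<in>V. v \<noteq> w \<and> e \<in> Op v \<and> f \<in> Ip w"
    using adt by (simp add: adt_network_def)
  from bspec[OF this assms] show ?thesis by simp
qed

lemma finite_in_ports: "\<Omega> \<subseteq> V \<Longrightarrow> finite (\<Union>(Ip ` \<Omega>))"
  and finite_out_ports: "\<Omega> \<subseteq> V \<Longrightarrow> finite (\<Union>(Op ` \<Omega>))"
  using finite_subset[OF _ finite_nodes] finite_ports by (simp_all add: subset_iff)

lemma finite_in_edges: "finite {e. (e, f) \<in> E}"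
proof (rule finite_subset)
  show "{e. (e, f) \<in> E} \<subseteq> \<Union>(Op ` V)" using edge_ports by blast
qed (rule finite_out_ports[OF subset_refl])

definition depth :: "'v \<Rightarrow> nat" where
  "depth v = card {u. (u, v) \<in> (node_graph V Ip Op E)\<^sup>+}"

text \<open>\<open>depth\<close> counts strict ancestors. Those of \<open>v\<close> are also
  ancestors of \<open>w\<close>, and \<open>v\<close> is a further one, as acyclicity keeps it from
  being its own ancestor.\<close>

lemma depth_less:
  assumes "v \<in> V" "w \<in> V" "e \<in> Op v" "f \<in> Ip w" "(e, f) \<in> E"
  shows "depth v < depth w"
proof -
  let ?G = "node_graph V Ip Op E"
  have vw: "(v, w) \<in> ?G" using assms by (auto simp: node_graph_def)
  have "?G \<subseteq> V \<times> V" by (auto simp: node_graph_def)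
  then have "?G\<^sup>+ \<subseteq> V \<times> V" by (rule trancl_subset_Sigma)
  then have "{u. (u, w) \<in> ?G\<^sup>+} \<subseteq> V" by blast
  then have "finite {u. (u, w) \<in> ?G\<^sup>+}" using finite_nodes by (rule finite_subset)
  moreover have "{u. (u, v) \<in> ?G\<^sup>+} \<subset> {u. (u, w) \<in> ?G\<^sup>+}"
  proof
    show "{u. (u, v) \<in> ?G\<^sup>+} \<subseteq> {u. (u, w) \<in> ?G\<^sup>+}" 
      using vw trancl_into_trancl[of _ v ?G w] by blast
    have "(v, v) \<notin> ?G\<^sup>+" using net unfolding acyclic_adt_network_def acyclic_def by blast
    then show "{u. (u, v) \<in> ?G\<^sup>+} \<noteq> {u. (u, w) \<in> ?G\<^sup>+}" using vw by blast
  qed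
  ultimately show ?thesis unfolding depth_def by (rule psubset_card_mono)
qed

text \<open>The two propagation clauses of \<open>code_establishes\<close>, over the integers.
  Decoding is kept apart because exact decoding could require division.\<close>

definition integral_code ::
  "'v \<Rightarrow> 'k set \<Rightarrow> ('k \<Rightarrow> 'p \<Rightarrow> int) \<Rightarrow> ('p \<Rightarrow> 'p \<Rightarrow> int) \<Rightarrow> ('p \<Rightarrow> 'k \<Rightarrow> int) \<Rightarrow> bool" where
  "integral_code S XS \<alpha> \<beta> Y \<longleftrightarrow>
    (\<forall>v\<in>V. \<forall>e\<in>Op v. \<forall>k\<in>XS. Y e k = (\<Sum>f\<in>Ip v. \<beta> f e * Y f k) + (if v = S then \<alpha> k e else 0)) \<and>
    (\<forall>v\<in>V. \<forall>f\<in>Ip v. \<forall>k\<in>XS. Y f k = (\<Sum>e\<in>{e. (e, f) \<in> E}. Y e k))"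

text \<open>The owner of a process is the destination of the disjoint multicast that wants it, or the source
  if there is none, so that the super-destination always has as many inputs as there are processes
  and its transfer matrix \<open>Z\<close> is square.\<close>

lemma integral_code_exists:
  fixes XS :: "'k set"
  assumes S: "S \<in> V" and XS: "finite XS"
    and owner: "\<And>x. x \<in> XS \<Longrightarrow> owner x \<in> V"
    and \<T>: "\<T> \<subseteq> V"
    and cut_owner: "\<And>\<Omega>. \<Omega> \<subseteq> V \<Longrightarrow> S \<in> \<Omega> \<Longrightarrow> card {x\<in>XS. owner x \<notin> \<Omega>}
      \<le> rk (\<Union>(Op ` \<Omega>)) (\<Union>(Ip ` (V - \<Omega>))) (adjacency E :: _ \<Rightarrow> _ \<Rightarrow> rat)"
    and cut_multi: "\<And>\<Omega> t. \<Omega> \<subseteq> V \<Longrightarrow> S \<in> \<Omega> \<Longrightarrow> t \<in> \<T> \<Longrightarrow> card XS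
      \<le> rk (\<Union>(Op ` (\<Omega> - {t}))) (\<Union>(Ip ` (V - (\<Omega> - {t})))) (adjacency E :: _ \<Rightarrow> _ \<Rightarrow> rat)"
  shows "\<exists>\<alpha> \<beta> \<epsilon> Y Z. integral_code S XS \<alpha> \<beta> Y \<and>
    (\<forall>x\<in>XS. owner x \<noteq> S \<longrightarrow> (\<forall>k\<in>XS. Z x k = (\<Sum>f\<in>Ip (owner x). \<epsilon> f x * Y f k))) \<and>
    card XS \<le> rk XS XS (\<lambda>k x. rat_of_int (Z x k)) \<and>
    (\<forall>t\<in>\<T>. card XS \<le> rk XS (Ip t) (\<lambda>k f. rat_of_int (Y f k)))"
proof -
  define Ip' :: "'v \<Rightarrow> ('p, 'k) ext_port set"
    where "Ip' v = Port ` Ip v \<union> (if v = S then Src ` XS else {})" for v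
  define Op' :: "'v \<Rightarrow> ('p, 'k) ext_port set"
    where "Op' v = Port ` Op v \<union> Snk ` {x\<in>XS. owner x = v}" for v
  define s :: "('p, 'k) ext_port set" where "s = Src ` XS"
  \<comment> \<open>The receivers: the inputs of the super-destination, and for each multicast
    destination its own input ports a second time, now as a set that must attain full rank.\<close>
  define \<J> :: "('p, 'k) ext_port set set" where "\<J> = insert (Snk ` XS) ((\<lambda>t. Port ` Ip t) ` \<T>)"
  define g :: "('p, 'k) ext_port \<Rightarrow> ('p, 'k) ext_port \<Rightarrow> rat" where "g = ext_adjacency E"
  define rows where "rows = s \<union> \<Union>(Op' ` V)"
  have Port_Ip: "Port ` \<Union>(Ip ` W) \<subseteq> \<Union>(Ip' ` W)" for W
    unfolding image_UN by (intro UN_mono) (auto simp: Ip'_def)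
  have fin: "finite V" "finite \<T>" using finite_nodes \<T> finite_subset by auto
  have fin': "finite (Ip' v)" "finite (Op' v)" if "v \<in> V" for v
    using that finite_ports[OF that] XS by (auto simp: Ip'_def Op'_def)
  have fin_rows: "finite rows" using fin fin' XS by (auto simp: rows_def s_def)
  have fin_\<J>: "finite J" if "J \<in> \<J>" for J
    using that XS \<T> finite_ports by (auto simp: \<J>_def)
  have acyc: "depth v < depth w" if "v \<in> V" "w \<in> V" "e \<in> Op' v" "f \<in> Ip' w" "g e f \<noteq> 0" for v w e f
    using that by (auto simp: Op'_def Ip'_def g_def adjacency_def split: if_splits intro: depth_less)
  have ints: "g e f \<in> \<int>" for e f
    by (cases "(E, e, f)" rule: ext_adjacency.cases) (auto simp: g_def adjacency_def)
  have cut: "card XS \<le> rk (s \<union> \<Union>(Op' ` \<Omega>)) (\<Union>(Ip' ` (V - \<Omega>)) \<union> J) g"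
    if J: "J \<in> \<J>" and \<Omega>: "\<Omega> \<subseteq> V" for J \<Omega>
  proof -
    have finC: "finite (\<Union>(Ip' ` (V - \<Omega>)) \<union> J)" using fin fin' fin_\<J>[OF J] by auto
    \<comment> \<open>A source on the far side leaves all virtual wires in the cut. Otherwise the
      super-destination gets the cut rank plus the sink ports of owners on the near side, and a
      multicast destination is moved to the far side, which removes rows and adds only columns that
      already belong to \<open>J\<close>.\<close>
    consider "S \<notin> \<Omega>" | "S \<in> \<Omega>" "J = Snk ` XS" | t where "S \<in> \<Omega>" "t \<in> \<T>" "J = Port ` Ip t"
      using J by (auto simp: \<J>_def)
    then show ?thesis
    proof cases
      case 1
      then have "Src ` XS \<subseteq> \<Union>(Ip' ` (V - \<Omega>)) \<union> J" using S by (auto simp: Ip'_def)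
      then show ?thesis unfolding g_def s_def
        using finC by (intro card_sources_le_rk_ext_adjacency[OF XS]) auto
    next
      case 2
      obtain J0 where J0: "J0 \<subseteq> \<Union>(Ip ` (V - \<Omega>))"
        "indep_cols (\<Union>(Op ` \<Omega>)) J0 (adjacency E :: _ \<Rightarrow> _ \<Rightarrow> rat)"
        "card J0 = rk (\<Union>(Op ` \<Omega>)) (\<Union>(Ip ` (V - \<Omega>))) (adjacency E :: _ \<Rightarrow> _ \<Rightarrow> rat)" "finite J0"
        by (rule rk_basis_exists[OF finite_in_ports[of "V - \<Omega>"]]) auto
      have "card J0 + card {x\<in>XS. owner x \<in> \<Omega>} \<le> rk (s \<union> \<Union>(Op' ` \<Omega>)) (\<Union>(Ip' ` (V - \<Omega>)) \<union> J) g"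
        unfolding g_def
      proof (rule card_le_rk_ext_adjacency[OF J0(4,2) _ _ _ finC])
        show "finite {x \<in> XS. owner x \<in> \<Omega>}" using XS by simp
        show "Port ` \<Union> (Op ` \<Omega>) \<union> Snk ` {x \<in> XS. owner x \<in> \<Omega>} \<subseteq> s \<union> \<Union> (Op' ` \<Omega>)"
          by (auto simp: Op'_def)
        show "Port ` J0 \<union> Snk ` {x \<in> XS. owner x \<in> \<Omega>} \<subseteq> \<Union> (Ip' ` (V - \<Omega>)) \<union> J"
          using subset_trans[OF image_mono[OF J0(1)] Port_Ip] unfolding 2(2) by blast
      qed
      moreover have "card XS = card {x\<in>XS. owner x \<notin> \<Omega>} + card {x\<in>XS. owner x \<in> \<Omega>}"
        using XS by (subst card_Un_disjoint[symmetric]) (auto intro: arg_cong[of _ _ card])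
      ultimately show ?thesis using cut_owner[OF \<Omega> 2(1)] J0(3) by linarith
    next
      case 3
      let ?\<Omega> = "\<Omega> - {t}"
      obtain J0 where J0: "J0 \<subseteq> \<Union>(Ip ` (V - ?\<Omega>))"
        "indep_cols (\<Union>(Op ` ?\<Omega>)) J0 (adjacency E :: _ \<Rightarrow> _ \<Rightarrow> rat)"
        "card J0 = rk (\<Union>(Op ` ?\<Omega>)) (\<Union>(Ip ` (V - ?\<Omega>))) (adjacency E :: _ \<Rightarrow> _ \<Rightarrow> rat)" "finite J0"
        by (rule rk_basis_exists[OF finite_in_ports[of "V - ?\<Omega>"]]) auto
      have "card J0 + card ({} :: 'k set) \<le> rk (s \<union> \<Union>(Op' ` \<Omega>)) (\<Union>(Ip' ` (V - \<Omega>)) \<union> J) g"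
        unfolding g_def
      proof (rule card_le_rk_ext_adjacency[OF J0(4,2) _ _ _ finC])
        show "Port ` \<Union> (Op ` ?\<Omega>) \<union> Snk ` {} \<subseteq> s \<union> \<Union> (Op' ` \<Omega>)"
          by (auto simp: Op'_def)
        show "Port ` J0 \<union> Snk ` {} \<subseteq> \<Union> (Ip' ` (V - \<Omega>)) \<union> J"
        proof -
          have "J0 \<subseteq> \<Union>(Ip ` (V - \<Omega>)) \<union> Ip t" using J0(1) by blast
          then have "Port ` J0 \<subseteq> Port ` \<Union>(Ip ` (V - \<Omega>)) \<union> J"
            unfolding 3(3) image_Un[symmetric] by (rule image_mono)
          then show ?thesis using Port_Ip[of "V - \<Omega>"] by blast
        qed
      qed simp
      then show ?thesis using cut_multi[OF \<Omega> 3(1,2)] J0(3) by simp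
    qed
  qed
  have "\<exists>\<beta> M. (\<forall>f e. \<beta> f e \<in> \<int>) \<and> (\<forall>e f. M e f \<in> \<int>) \<and> (\<forall>J\<in>\<J>. card XS \<le> rk s J M) \<and>
    (\<forall>y. \<exists>Yo Yi. (\<forall>e\<in>s. Yo e = y e) \<and>
      (\<forall>v\<in>V. \<forall>e\<in>Op' v. Yo e = (\<Sum>f\<in>Ip' v. \<beta> f e * Yi f)) \<and>
      (\<forall>f. Yi f = (\<Sum>e\<in>rows. g e f * Yo e)) \<and>
      (\<forall>f. Yi f = (\<Sum>e\<in>s. M e f * y e)))"
    unfolding rows_def
  proof (rule node_elimination[OF fin(1) _ _ fin_\<J> _ _ _ acyc ints cut])
    show "finite s" using XS by (simp add: s_def)
    show "finite \<J>" using fin by (simp add: \<J>_def)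
    show "Op' v \<inter> Op' w = {}" if "v \<in> V" "w \<in> V" "v \<noteq> w" for v w
      using ports_disjoint(2)[OF that] that(3) by (auto simp: Op'_def)
  qed (use fin' in \<open>auto simp: Op'_def s_def\<close>)
  then obtain \<beta>' M where \<beta>': "\<And>f e. \<beta>' f e \<in> \<int>" and M: "\<And>e f. M e f \<in> \<int>"
    and rkM: "\<And>J. J \<in> \<J> \<Longrightarrow> card XS \<le> rk s J M"
    and sol: "\<And>y. \<exists>Yo Yi. (\<forall>e\<in>s. Yo e = y e) \<and>
      (\<forall>v\<in>V. \<forall>e\<in>Op' v. Yo e = (\<Sum>f\<in>Ip' v. \<beta>' f e * Yi f)) \<and>
      (\<forall>f. Yi f = (\<Sum>e\<in>rows. g e f * Yo e)) \<and>
      (\<forall>f. Yi f = (\<Sum>e\<in>s. M e f * y e))" by blast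
  \<comment> \<open>Feeding one unit process at a time makes the symbol on a port for input
    \<open>k\<close> the coordinate at \<open>k\<close> of its global coding vector.\<close>
  have "\<forall>k. \<exists>Yo Yi. (\<forall>e\<in>s. Yo e = (if e = Src k then 1 else 0)) \<and>
      (\<forall>v\<in>V. \<forall>e\<in>Op' v. Yo e = (\<Sum>f\<in>Ip' v. \<beta>' f e * Yi f)) \<and>
      (\<forall>f. Yi f = (\<Sum>e\<in>rows. g e f * Yo e)) \<and>
      (\<forall>f. Yi f = (\<Sum>e\<in>s. M e f * (if e = Src k then 1 else 0)))"
    by (intro allI sol)
  from choice[OF this] obtain Yo where "\<forall>k. \<exists>Yi. (\<forall>e\<in>s. Yo k e = (if e = Src k then 1 else 0)) \<and>
      (\<forall>v\<in>V. \<forall>e\<in>Op' v. Yo k e = (\<Sum>f\<in>Ip' v. \<beta>' f e * Yi f)) \<and>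
      (\<forall>f. Yi f = (\<Sum>e\<in>rows. g e f * Yo k e)) \<and>
      (\<forall>f. Yi f = (\<Sum>e\<in>s. M e f * (if e = Src k then 1 else 0)))" by blast
  from choice[OF this] obtain Yi where
    Yo_s: "\<And>k e. e \<in> s \<Longrightarrow> Yo k e = (if e = Src k then 1 else 0)" and
    Yo: "\<And>k v e. v \<in> V \<Longrightarrow> e \<in> Op' v \<Longrightarrow> Yo k e = (\<Sum>f\<in>Ip' v. \<beta>' f e * Yi k f)" and
    Yi: "\<And>k f. Yi k f = (\<Sum>e\<in>rows. g e f * Yo k e)" and
    YiM: "\<And>k f. Yi k f = (\<Sum>e\<in>s. M e f * (if e = Src k then 1 else 0))" by blast
  have Yi_eq_M: "Yi k f = M (Src k) f" if "k \<in> XS" for k f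
    using that XS by (simp add: YiM s_def if_distrib[of "\<lambda>x. _ * x"] cong: if_cong)
  have Yi_Ints: "Yi k f \<in> \<int>" if "k \<in> XS" for k f using Yi_eq_M[OF that] M by simp
  have Yi_Src: "Yi k (Src x) = (if x = k then 1 else 0)" if "x \<in> XS" for k x
  proof -
    have "Yi k (Src x) = (\<Sum>e\<in>{Src x}. g e (Src x) * Yo k e)"
      unfolding Yi
    proof (rule sum_eq_sum_support[OF fin_rows])
      show "{Src x} \<subseteq> rows" using that by (auto simp: rows_def s_def)
      show "g e (Src x) * Yo k e = 0" if "e \<in> rows" "e \<notin> {Src x}" for e
        using that by (cases e) (auto simp: g_def)
    qed
    also have "\<dots> = (if x = k then 1 else 0)"
      using Yo_s[of "Src x" k] that by (simp add: g_def s_def)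
    finally show ?thesis .
  qed
  have Yi_Snk: "Yi k (Snk x) = Yo k (Snk x)" if "x \<in> XS" for k x
  proof -
    have "Yi k (Snk x) = (\<Sum>e\<in>{Snk x}. g e (Snk x) * Yo k e)"
      unfolding Yi
    proof (rule sum_eq_sum_support[OF fin_rows])
      show "{Snk x} \<subseteq> rows" using that owner[OF that] by (auto simp: rows_def Op'_def)
      show "g e (Snk x) * Yo k e = 0" if "e \<in> rows" "e \<notin> {Snk x}" for e
        using that by (cases e) (auto simp: g_def)
    qed
    then show ?thesis by (simp add: g_def)
  qed
  have Yi_Port: "Yi k (Port f) = (\<Sum>e\<in>{e. (e, f) \<in> E}. Yo k (Port e))" for k f
  proof -
    have "Yi k (Port f) = (\<Sum>e\<in>Port ` {e. (e, f) \<in> E}. g e (Port f) * Yo k e)"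
      unfolding Yi
    proof (rule sum_eq_sum_support[OF fin_rows])
      show "Port ` {e. (e, f) \<in> E} \<subseteq> rows"
        using edge_ports[of _ f] by (fastforce simp: rows_def Op'_def)
      show "g e (Port f) * Yo k e = 0" if "e \<in> rows" "e \<notin> Port ` {e. (e, f) \<in> E}" for e
        using that by (cases e) (auto simp: g_def adjacency_def)
    qed
    also have "\<dots> = (\<Sum>e\<in>{e. (e, f) \<in> E}. Yo k (Port e))"
      by (subst sum.reindex) (auto simp: inj_on_def g_def adjacency_def intro: sum.cong)
    finally show ?thesis .
  qed
  have sum_Ip': "(\<Sum>i\<in>Ip' v. h i)
      = (\<Sum>f\<in>Ip v. h (Port f)) + (if v = S then (\<Sum>x\<in>XS. h (Src x)) else 0)" if "v \<in> V"
    for h :: "_ \<Rightarrow> rat" and v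
  proof (cases "v = S")
    case True
    have "(\<Sum>i\<in>Port ` Ip v \<union> Src ` XS. h i) = (\<Sum>i\<in>Port ` Ip v. h i) + (\<Sum>i\<in>Src ` XS. h i)"
      using finite_ports[OF that] XS by (intro sum.union_disjoint) auto
    then show ?thesis using True by (simp add: Ip'_def sum.reindex inj_on_def)
  next
    case False
    then show ?thesis by (simp add: Ip'_def sum.reindex inj_on_def)
  qed
  \<comment> \<open>For processes in \<open>XS\<close> and ports of the network the rounded values
    are integers, so the floor only changes the type; no port of the network is both an input and an
    output, which makes the case split consistent.\<close>
  define Y where "Y = (\<lambda>p k. if p \<in> \<Union>(Op ` V) then \<lfloor>Yo k (Port p)\<rfloor> else \<lfloor>Yi k (Port p)\<rfloor>)"
  \<comment> \<open>The node code splits by kinds of ports: entries from virtual source ports become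
    \<open>\<alpha>\<close>, and those from real input ports into sink ports become
    \<open>\<epsilon>\<close>.\<close>
  define \<alpha> where "\<alpha> = (\<lambda>k e. \<lfloor>\<beta>' (Src k) (Port e)\<rfloor>)"
  define \<beta> where "\<beta> = (\<lambda>f e. \<lfloor>\<beta>' (Port f) (Port e)\<rfloor>)"
  define \<epsilon> where "\<epsilon> = (\<lambda>f x. \<lfloor>\<beta>' (Port f) (Snk x)\<rfloor>)"
  define Z where "Z = (\<lambda>x k. \<lfloor>M (Src k) (Snk x)\<rfloor>)"
  have coef: "rat_of_int (\<alpha> k e) = \<beta>' (Src k) (Port e)" "rat_of_int (\<beta> f e) = \<beta>' (Port f) (Port e)"
    "rat_of_int (\<epsilon> f x) = \<beta>' (Port f) (Snk x)" "rat_of_int (Z x k) = M (Src k) (Snk x)" for k e f x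
    using \<beta>' M by (simp_all add: \<alpha>_def \<beta>_def \<epsilon>_def Z_def)
  have Yo_Ints: "Yo k e \<in> \<int>" if "v \<in> V" "e \<in> Op' v" "k \<in> XS" for k v e
    unfolding Yo[OF that(1,2)] using \<beta>' Yi_Ints[OF that(3)] by (intro Ints_sum Ints_mult)
  have Y_out: "rat_of_int (Y e k) = Yo k (Port e)" if "v \<in> V" "e \<in> Op v" "k \<in> XS" for v e k
  proof -
    have "e \<in> \<Union>(Op ` V)" "Port e \<in> Op' v" using that by (auto simp: Op'_def)
    then show ?thesis using Yo_Ints[OF that(1) _ that(3)] by (simp add: Y_def)
  qed
  have Y_in: "rat_of_int (Y f k) = Yi k (Port f)" if "v \<in> V" "f \<in> Ip v" "k \<in> XS" for v f k
  proof -
    have "f \<notin> \<Union>(Op ` V)" using that in_out_disjoint[OF that(1)] by blast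
    then show ?thesis using Yi_Ints[OF that(3)] by (simp add: Y_def)
  qed
  show ?thesis
    unfolding integral_code_def
  proof (rule exI[of _ \<alpha>], rule exI[of _ \<beta>], rule exI[of _ \<epsilon>], rule exI[of _ Y], rule exI[of _ Z],
      intro conjI ballI impI)
    fix v e k assume ve: "v \<in> V" "e \<in> Op v" and k: "k \<in> XS"
    have "rat_of_int (Y e k) = (\<Sum>i\<in>Ip' v. \<beta>' i (Port e) * Yi k i)"
      using Y_out[OF ve k] Yo[OF ve(1), of "Port e" k] ve by (simp add: Op'_def)
    also have "\<dots> = (\<Sum>f\<in>Ip v. rat_of_int (\<beta> f e * Y f k)) + (if v = S then rat_of_int (\<alpha> k e) else 0)"
      using k XS Y_in[OF ve(1) _ k]
      by (simp add: sum_Ip'[OF ve(1)] coef Yi_Src if_distrib[of "\<lambda>x. _ * x"] cong: if_cong)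
    also have "\<dots> = rat_of_int ((\<Sum>f\<in>Ip v. \<beta> f e * Y f k) + (if v = S then \<alpha> k e else 0))" by simp
    finally show "Y e k = (\<Sum>f\<in>Ip v. \<beta> f e * Y f k) + (if v = S then \<alpha> k e else 0)"
      by (simp only: of_int_eq_iff)
  next
    fix v f k assume vf: "v \<in> V" "f \<in> Ip v" and k: "k \<in> XS"
    have "rat_of_int (Y e k) = Yo k (Port e)" if "(e, f) \<in> E" for e
      using edge_ports[OF that] Y_out k by blast
    then have "rat_of_int (Y f k) = rat_of_int (\<Sum>e\<in>{e. (e, f) \<in> E}. Y e k)"
      using Y_in[OF vf k] by (simp add: Yi_Port)
    then show "Y f k = (\<Sum>e\<in>{e. (e, f) \<in> E}. Y e k)" by (simp only: of_int_eq_iff)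
  next
    fix x k assume x: "x \<in> XS" "owner x \<noteq> S" and k: "k \<in> XS"
    have "rat_of_int (Z x k) = Yo k (Snk x)" 
      using Yi_eq_M[OF k, of "Snk x"] Yi_Snk[OF x(1), of k] by (simp add: coef)
    \<comment> \<open>Only at the source does \<open>Ip'\<close> contain virtual ports, so any other
      owner forms \<open>Z x k\<close> from symbols that it really receives.\<close>
    also have "\<dots> = (\<Sum>i\<in>Ip' (owner x). \<beta>' i (Snk x) * Yi k i)"
      using x by (intro Yo owner) (auto simp: Op'_def)
    also have "\<dots> = rat_of_int (\<Sum>f\<in>Ip (owner x). \<epsilon> f x * Y f k)"
      using x Y_in[OF owner[OF x(1)] _ k] by (simp add: sum_Ip'[OF owner[OF x(1)]] coef)
    finally show "Z x k = (\<Sum>f\<in>Ip (owner x). \<epsilon> f x * Y f k)" by (simp only: of_int_eq_iff)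
  next
    have "card XS \<le> rk s (Snk ` XS) M" by (rule rkM) (simp add: \<J>_def)
    also have "\<dots> \<le> rk XS XS (\<lambda>k x. M (Src k) (Snk x))"
      unfolding s_def using XS by (intro rk_image_le) (auto simp: inj_on_def)
    finally show "card XS \<le> rk XS XS (\<lambda>k x. rat_of_int (Z x k))" by (simp add: coef)
  next
    fix t assume t: "t \<in> \<T>"
    have "card XS \<le> rk s (Port ` Ip t) M" by (rule rkM) (use t in \<open>simp add: \<J>_def\<close>)
    also have "\<dots> \<le> rk XS (Ip t) (\<lambda>k f. M (Src k) (Port f))"
      unfolding s_def using finite_ports t \<T> by (intro rk_image_le) (auto simp: inj_on_def)
    also have "\<dots> = rk XS (Ip t) (\<lambda>k f. rat_of_int (Y f k))"
      using t \<T> Y_in Yi_eq_M by (intro rk_cong) (metis subsetD)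
    finally show "card XS \<le> rk XS (Ip t) (\<lambda>k f. rat_of_int (Y f k))" .
  qed
qed

end

text \<open>Decoding up to a nonzero factor \<open>c\<close>, which becomes a unit modulo a large
  prime; this keeps decoders integral.\<close>

definition decodes :: "int \<Rightarrow> ('p \<Rightarrow> 'k \<Rightarrow> int) \<Rightarrow> 'k set \<Rightarrow> 'p set \<Rightarrow> 'k \<Rightarrow> bool" where
  "decodes c Y XS P x \<longleftrightarrow> c \<noteq> 0 \<and> (\<exists>\<epsilon>. \<forall>k\<in>XS. (\<Sum>f\<in>P. \<epsilon> f * Y f k) = (if k = x then c else 0))"

section \<open>Precoding at the source and reduction modulo a prime\<close>

context acyclic_adt
begin

text \<open>Precoding at the source with a scaled inverse of \<open>Z\<close> removes the interference at the owners and
  costs the multicast destinations no rank.\<close>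

lemma precoded_integral_code_exists:
  fixes XS :: "'k set"
  assumes S: "S \<in> V" and XS: "finite XS"
    and owner: "\<And>x. x \<in> XS \<Longrightarrow> owner x \<in> V"
    and \<T>: "\<T> \<subseteq> V"
    and cut_owner: "\<And>\<Omega>. \<Omega> \<subseteq> V \<Longrightarrow> S \<in> \<Omega> \<Longrightarrow> card {x\<in>XS. owner x \<notin> \<Omega>}
      \<le> rk (\<Union>(Op ` \<Omega>)) (\<Union>(Ip ` (V - \<Omega>))) (adjacency E :: _ \<Rightarrow> _ \<Rightarrow> rat)"
    and cut_multi: "\<And>\<Omega> t. \<Omega> \<subseteq> V \<Longrightarrow> S \<in> \<Omega> \<Longrightarrow> t \<in> \<T> \<Longrightarrow> card XS
      \<le> rk (\<Union>(Op ` (\<Omega> - {t}))) (\<Union>(Ip ` (V - (\<Omega> - {t})))) (adjacency E :: _ \<Rightarrow> _ \<Rightarrow> rat)"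
  shows "\<exists>\<alpha> \<beta> Y. integral_code S XS \<alpha> \<beta> Y \<and>
    (\<forall>x\<in>XS. owner x \<noteq> S \<longrightarrow> (\<exists>c. decodes c Y XS (Ip (owner x)) x)) \<and>
    (\<forall>t\<in>\<T>. \<forall>x\<in>XS. \<exists>c. decodes c Y XS (Ip t) x)"
proof -
  have "\<exists>\<alpha> \<beta> \<epsilon> Y Z. integral_code S XS \<alpha> \<beta> Y \<and>
    (\<forall>x\<in>XS. owner x \<noteq> S \<longrightarrow> (\<forall>k\<in>XS. Z x k = (\<Sum>f\<in>Ip (owner x). \<epsilon> f x * Y f k))) \<and>
    card XS \<le> rk XS XS (\<lambda>k x. rat_of_int (Z x k)) \<and>
    (\<forall>t\<in>\<T>. card XS \<le> rk XS (Ip t) (\<lambda>k f. rat_of_int (Y f k)))"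
    by (rule integral_code_exists[OF S XS owner \<T> cut_owner cut_multi])
  then obtain \<alpha> \<beta> \<epsilon> Y Z where code: "integral_code S XS \<alpha> \<beta> Y" and
    Z: "\<forall>x\<in>XS. owner x \<noteq> S \<longrightarrow> (\<forall>k\<in>XS. Z x k = (\<Sum>f\<in>Ip (owner x). \<epsilon> f x * Y f k))" and
    rkZ: "card XS \<le> rk XS XS (\<lambda>k x. rat_of_int (Z x k))" and
    rkY: "\<forall>t\<in>\<T>. card XS \<le> rk XS (Ip t) (\<lambda>k f. rat_of_int (Y f k))"
    by (elim exE conjE) (rule that)
  have out: "Y e k = (\<Sum>f\<in>Ip v. \<beta> f e * Y f k) + (if v = S then \<alpha> k e else 0)"
    if "v \<in> V" "e \<in> Op v" "k \<in> XS" for v e k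
    using code that unfolding integral_code_def by blast
  have inp: "Y f k = (\<Sum>e\<in>{e. (e, f) \<in> E}. Y e k)" if "v \<in> V" "f \<in> Ip v" "k \<in> XS" for v f k
    using code that unfolding integral_code_def by blast
  \<comment> \<open>\<open>Z\<close> maps the processes to the inputs of the super-destination, with
    interference; \<open>P\<close> inverts it up to the factor \<open>c\<close>.\<close>
  obtain c P where c: "c \<noteq> 0" and
    P: "\<And>x k. x \<in> XS \<Longrightarrow> k \<in> XS \<Longrightarrow> (\<Sum>l\<in>XS. Z x l * P l k) = (if x = k then c else 0)"
    using scaled_left_inverse[where M = "\<lambda>l x. Z x l", OF XS XS order_refl rkZ] by blast
  \<comment> \<open>The source feeds combinations formed by \<open>P\<close> in place of the
    processes. All code equations are linear, so \<open>\<beta>\<close> stays and only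
    \<open>\<alpha>\<close> is precoded.\<close>
  define Y' where "Y' = (\<lambda>p k. \<Sum>l\<in>XS. Y p l * P l k)"
  define \<alpha>' where "\<alpha>' = (\<lambda>k e. \<Sum>l\<in>XS. \<alpha> l e * P l k)"
  have lin: "(\<Sum>f\<in>A. u f * Y' f k) = (\<Sum>l\<in>XS. (\<Sum>f\<in>A. u f * Y f l) * P l k)" for A u k
    unfolding Y'_def sum_distrib_left sum_distrib_right by (subst sum.swap) (simp add: mult_ac)
  have out': "Y' e k = (\<Sum>f\<in>Ip v. \<beta> f e * Y' f k) + (if v = S then \<alpha>' k e else 0)"
    if "v \<in> V" "e \<in> Op v" for v e k
  proof -
    have "Y' e k = (\<Sum>l\<in>XS. ((\<Sum>f\<in>Ip v. \<beta> f e * Y f l) + (if v = S then \<alpha> l e else 0)) * P l k)"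
      unfolding Y'_def using out[OF that] by (intro sum.cong) auto
    then show ?thesis by (simp add: lin \<alpha>'_def distrib_right sum.distrib)
  qed
  have inp': "Y' f k = (\<Sum>e\<in>{e. (e, f) \<in> E}. Y' e k)" if "v \<in> V" "f \<in> Ip v" for v f k
  proof -
    have "Y' f k = (\<Sum>l\<in>XS. (\<Sum>e\<in>{e. (e, f) \<in> E}. Y e l) * P l k)"
      unfolding Y'_def using inp[OF that] by (intro sum.cong) auto
    also have "\<dots> = (\<Sum>e\<in>{e. (e, f) \<in> E}. Y' e k)"
      unfolding Y'_def sum_distrib_right by (rule sum.swap)
    finally show ?thesis .
  qed
  have "decodes c Y' XS (Ip (owner x)) x" if x: "x \<in> XS" "owner x \<noteq> S" for x
    unfolding decodes_def
  proof (intro conjI c exI[of _ "\<lambda>f. \<epsilon> f x"] ballI)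
    fix k assume k: "k \<in> XS"
    have "(\<Sum>f\<in>Ip (owner x). \<epsilon> f x * Y' f k) = (\<Sum>l\<in>XS. Z x l * P l k)"
      unfolding lin using Z x by (intro sum.cong) auto
    then show "(\<Sum>f\<in>Ip (owner x). \<epsilon> f x * Y' f k) = (if k = x then c else 0)" using P[OF x(1) k] by auto
  qed
  moreover have "\<exists>c. decodes c Y' XS (Ip t) x" if t: "t \<in> \<T>" and x: "x \<in> XS" for t x
  proof -
    have "finite (Ip t)" using t \<T> finite_ports by blast
    from scaled_right_inverse[OF XS this bspec[OF rkY t]] obtain d \<eta> where d: "d \<noteq> 0" and
      \<eta>: "\<And>k l. k \<in> XS \<Longrightarrow> l \<in> XS \<Longrightarrow> (\<Sum>f\<in>Ip t. \<eta> f k * Y f l) = (if l = k then d else 0)" by blast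
    \<comment> \<open>A multicast destination recovers \<open>d\<close> times the precoded processes
      by \<open>\<eta>\<close> and then applies \<open>Z\<close>, which undoes \<open>P\<close> up
      to \<open>c\<close>.\<close>
    have "(\<Sum>f\<in>Ip t. (\<Sum>j\<in>XS. Z x j * \<eta> f j) * Y' f k) = (if k = x then c * d else 0)" if k: "k \<in> XS" for k
    proof -
      have inner: "(\<Sum>f\<in>Ip t. (\<Sum>j\<in>XS. Z x j * \<eta> f j) * Y f l) = d * Z x l" if l: "l \<in> XS" for l
      proof -
        have "(\<Sum>f\<in>Ip t. (\<Sum>j\<in>XS. Z x j * \<eta> f j) * Y f l) = (\<Sum>j\<in>XS. Z x j * (\<Sum>f\<in>Ip t. \<eta> f j * Y f l))"
          unfolding sum_distrib_left sum_distrib_right by (subst sum.swap) (simp add: mult_ac)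
        also have "\<dots> = (\<Sum>j\<in>XS. if j = l then d * Z x l else 0)"
          using \<eta> l by (intro sum.cong) auto
        finally show ?thesis using l XS by simp
      qed
      have "(\<Sum>f\<in>Ip t. (\<Sum>j\<in>XS. Z x j * \<eta> f j) * Y' f k) = (\<Sum>l\<in>XS. d * (Z x l * P l k))"
        unfolding lin using inner by (intro sum.cong) (auto simp: mult_ac)
      also have "\<dots> = d * (if x = k then c else 0)" using P[OF x k] by (simp add: sum_distrib_left[symmetric])
      finally show ?thesis by auto
    qed
    then have "decodes (c * d) Y' XS (Ip t) x"
      unfolding decodes_def using c d by (intro conjI exI[of _ "\<lambda>f. \<Sum>j\<in>XS. Z x j * \<eta> f j"]) auto
    then show ?thesis by blast
  qed
  moreover have "integral_code S XS \<alpha>' \<beta> Y'"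
    unfolding integral_code_def using out' inp' by blast
  ultimately show ?thesis by blast
qed

text \<open>Reduction modulo \<open>p\<close> is a homomorphism, so the code equations persist, and
  each decoder can be divided by its factor once \<open>p\<close> exceeds all of them in absolute
  value.\<close>

lemma solvable_if_integral_code:
  fixes XS :: "'k set" and Y :: "'p \<Rightarrow> 'k \<Rightarrow> int"
  assumes XS: "finite XS"
    and code: "integral_code S XS \<alpha> \<beta> Y"
    and C: "\<And>t X' x. (t, X') \<in> C \<Longrightarrow> x \<in> X' \<Longrightarrow> t \<in> V \<and> x \<in> XS \<and> (\<exists>c. decodes c Y XS (Ip t) x)"
  shows "solvable V Ip Op E S XS C"
proof -
  have out: "Y e k = (\<Sum>f\<in>Ip v. \<beta> f e * Y f k) + (if v = S then \<alpha> k e else 0)"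
    if "v \<in> V" "e \<in> Op v" "k \<in> XS" for v e k
    using code that unfolding integral_code_def by blast
  have inp: "Y f k = (\<Sum>e\<in>{e. (e, f) \<in> E}. Y e k)" if "v \<in> V" "f \<in> Ip v" "k \<in> XS" for v f k
    using code that unfolding integral_code_def by blast
  define D where "D = {(t, x) \<in> V \<times> XS. \<exists>c. decodes c Y XS (Ip t) x}"
  have "\<forall>d\<in>D. \<exists>c \<epsilon>. c \<noteq> 0 \<and> (\<forall>k\<in>XS. (\<Sum>f\<in>Ip (fst d). \<epsilon> f * Y f k) = (if k = snd d then c else 0))"
    by (auto simp: D_def decodes_def)
  from bchoice[OF this] obtain c where "\<forall>d\<in>D. \<exists>\<epsilon>. c d \<noteq> 0 \<and>
    (\<forall>k\<in>XS. (\<Sum>f\<in>Ip (fst d). \<epsilon> f * Y f k) = (if k = snd d then c d else 0))" by blast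
  from bchoice[OF this] obtain \<epsilon> where c0: "\<And>d. d \<in> D \<Longrightarrow> c d \<noteq> 0" and
    \<epsilon>: "\<And>t x k. (t, x) \<in> D \<Longrightarrow> k \<in> XS \<Longrightarrow>
      (\<Sum>f\<in>Ip t. \<epsilon> (t, x) f * Y f k) = (if k = x then c (t, x) else 0)" by fastforce
  have finD: "finite D"
    by (rule finite_subset[of _ "V \<times> XS"]) (use finite_nodes XS in \<open>auto simp: D_def\<close>)
  \<comment> \<open>There are finitely many demands, so one prime above the sum of the absolute
    values of their factors divides none of these factors.\<close>
  obtain p where p: "prime p" "nat (\<Sum>d\<in>D. \<bar>c d\<bar>) < p" using bigger_prime by blast
  have ndvd: "\<not> int p dvd c d" if d: "d \<in> D" for d
  proof
    assume "int p dvd c d"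
    then have "\<bar>int p\<bar> \<le> \<bar>c d\<bar>" by (rule dvd_imp_le_int[OF c0[OF d]])
    then have "int p \<le> \<bar>c d\<bar>" by simp
    also have "\<bar>c d\<bar> \<le> (\<Sum>d\<in>D. \<bar>c d\<bar>)" using finD d by (intro member_le_sum) auto
    also have "\<dots> < int p" using p(2) by linarith
    finally show False by simp
  qed
  have "\<forall>d\<in>D. \<exists>b. residue_of p (c d * b) = residue_of p 1"
    using residue_of_inverse[OF p(1) ndvd] by metis
  from bchoice[OF this] obtain b where b: "\<And>d. d \<in> D \<Longrightarrow> residue_of p (c d * b d) = residue_of p 1" by blast
  define F where "F = prime_field p"
  note hom = residue_of_mult[OF p(1), folded F_def] residue_of_add[OF p(1), folded F_def]
    residue_of_sum[OF p(1), folded F_def]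
  have zero: "\<zero>\<^bsub>F\<^esub> = residue_of p 0" and one: "\<one>\<^bsub>F\<^esub> = residue_of p 1"
    unfolding F_def by (rule residue_of_zero[OF p(1)] residue_of_one[OF p(1)])+
  have carr: "residue_of p a \<in> carrier F" for a
    unfolding F_def by (rule residue_of_in_carrier[OF p(1)])
  have "code_establishes F V Ip Op E S XS C (\<lambda>k e. residue_of p (\<alpha> k e)) (\<lambda>f e. residue_of p (\<beta> f e))
    (\<lambda>f t x. residue_of p (b (t, x) * \<epsilon> (t, x) f)) (\<lambda>e k. residue_of p (Y e k))"
    unfolding code_establishes_def
  proof (intro conjI allI ballI carr)
    fix v e k assume v: "v \<in> V" "e \<in> Op v" "k \<in> XS"
    have "(if v = S then residue_of p (\<alpha> k e) else \<zero>\<^bsub>F\<^esub>) = residue_of p (if v = S then \<alpha> k e else 0)"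
      by (simp add: zero)
    then show "residue_of p (Y e k) =
        (\<Oplus>\<^bsub>F\<^esub>e'\<in>Ip v. residue_of p (\<beta> e' e) \<otimes>\<^bsub>F\<^esub> residue_of p (Y e' k)) \<oplus>\<^bsub>F\<^esub>
        (if v = S then residue_of p (\<alpha> k e) else \<zero>\<^bsub>F\<^esub>)"
      using out[OF v] by (simp only: hom finite_ports[OF v(1)])
  next
    fix v f k assume v: "v \<in> V" "f \<in> Ip v" "k \<in> XS"
    show "residue_of p (Y f k) = (\<Oplus>\<^bsub>F\<^esub>e\<in>{e. (e, f) \<in> E}. residue_of p (Y e k))"
      using inp[OF v] by (simp only: hom finite_in_edges)
  next
    fix con assume con: "con \<in> C"
    show "case con of (t, X') \<Rightarrow> \<forall>x\<in>X'. \<forall>k\<in>XS.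
      (\<Oplus>\<^bsub>F\<^esub>e'\<in>Ip t. residue_of p (b (t, x) * \<epsilon> (t, x) e') \<otimes>\<^bsub>F\<^esub> residue_of p (Y e' k))
        = (if k = x then \<one>\<^bsub>F\<^esub> else \<zero>\<^bsub>F\<^esub>)"
    proof (clarify)
      fix t X' x k assume tX: "con = (t, X')" "x \<in> X'" and k: "k \<in> XS"
      have tx: "(t, x) \<in> D" "t \<in> V" using C[of t X' x] con tX by (auto simp: D_def)
      have "(\<Oplus>\<^bsub>F\<^esub>e'\<in>Ip t. residue_of p (b (t, x) * \<epsilon> (t, x) e') \<otimes>\<^bsub>F\<^esub> residue_of p (Y e' k))
          = residue_of p (\<Sum>e'\<in>Ip t. b (t, x) * \<epsilon> (t, x) e' * Y e' k)"
        by (simp only: hom finite_ports[OF tx(2)])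
      also have "(\<Sum>e'\<in>Ip t. b (t, x) * \<epsilon> (t, x) e' * Y e' k) = b (t, x) * (if k = x then c (t, x) else 0)"
        using \<epsilon>[OF tx(1) k] by (simp add: sum_distrib_left[symmetric] mult.assoc)
      also have "residue_of p \<dots> = (if k = x then \<one>\<^bsub>F\<^esub> else \<zero>\<^bsub>F\<^esub>)"
        using b[OF tx(1)] by (simp add: zero one mult.commute)
      finally show "(\<Oplus>\<^bsub>F\<^esub>e'\<in>Ip t. residue_of p (b (t, x) * \<epsilon> (t, x) e') \<otimes>\<^bsub>F\<^esub> residue_of p (Y e' k))
        = (if k = x then \<one>\<^bsub>F\<^esub> else \<zero>\<^bsub>F\<^esub>)" .
    qed
  qed
  moreover have "field F" unfolding F_def by (rule prime_field_is_field[OF p(1)])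
  moreover have "finite (carrier F)" by (simp add: F_def prime_field_def)
  ultimately show ?thesis unfolding solvable_def by blast
qed

end

subsection \<open>Cuts bound every code\<close>

context field
begin

text \<open>Associativity \<open>u (m w) = (u m) w\<close> of matrix products, written with
  \<open>finsum\<close> as the field is a record.\<close>

lemma finsum_mult_assoc:
  assumes "finite A" "finite B" "\<And>a. a \<in> A \<Longrightarrow> u a \<in> carrier R"
    and "\<And>a b. a \<in> A \<Longrightarrow> b \<in> B \<Longrightarrow> m a b \<in> carrier R" "\<And>b. b \<in> B \<Longrightarrow> w b \<in> carrier R"
  shows "(\<Oplus>a\<in>A. u a \<otimes> (\<Oplus>b\<in>B. m a b \<otimes> w b)) = (\<Oplus>b\<in>B. (\<Oplus>a\<in>A. u a \<otimes> m a b) \<otimes> w b)"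
  using assms
proof (induction A rule: finite_induct)
  case empty
  then have "(\<Oplus>b\<in>B. \<zero> \<otimes> w b) = (\<Oplus>b\<in>B. \<zero>)" by (intro finsum_cong') auto
  then show ?case by simp
next
  case (insert x A)
  have mc: "m a b \<in> carrier R" if "a \<in> insert x A" "b \<in> B" for a b
    using insert.prems(3) that by blast
  have uc: "u a \<in> carrier R" if "a \<in> insert x A" for a using insert.prems(2) that by blast
  note wc = insert.prems(4)
  have sc: "(\<Oplus>a\<in>A. u a \<otimes> m a b) \<in> carrier R" if "b \<in> B" for b
    using uc mc that by (intro finsum_closed) auto
  have "(\<Oplus>a\<in>insert x A. u a \<otimes> (\<Oplus>b\<in>B. m a b \<otimes> w b))
      = u x \<otimes> (\<Oplus>b\<in>B. m x b \<otimes> w b) \<oplus> (\<Oplus>a\<in>A. u a \<otimes> (\<Oplus>b\<in>B. m a b \<otimes> w b))"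
    using insert.hyps uc mc wc by (intro finsum_insert) (auto intro!: finsum_closed)
  also have "(\<Oplus>a\<in>A. u a \<otimes> (\<Oplus>b\<in>B. m a b \<otimes> w b)) = (\<Oplus>b\<in>B. (\<Oplus>a\<in>A. u a \<otimes> m a b) \<otimes> w b)"
    using insert.IH[OF insert.prems(1)] uc mc wc by blast
  also have "u x \<otimes> (\<Oplus>b\<in>B. m x b \<otimes> w b) = (\<Oplus>b\<in>B. u x \<otimes> (m x b \<otimes> w b))"
    using uc mc wc insert.prems(1) by (intro finsum_rdistr) auto
  also have "\<dots> \<oplus> (\<Oplus>b\<in>B. (\<Oplus>a\<in>A. u a \<otimes> m a b) \<otimes> w b)
      = (\<Oplus>b\<in>B. u x \<otimes> (m x b \<otimes> w b) \<oplus> (\<Oplus>a\<in>A. u a \<otimes> m a b) \<otimes> w b)"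
    using uc mc wc sc by (intro finsum_addf[symmetric]) auto
  also have "\<dots> = (\<Oplus>b\<in>B. (\<Oplus>a\<in>insert x A. u a \<otimes> m a b) \<otimes> w b)"
  proof (rule finsum_cong')
    fix b assume b: "b \<in> B"
    have "(\<Oplus>a\<in>insert x A. u a \<otimes> m a b) = u x \<otimes> m x b \<oplus> (\<Oplus>a\<in>A. u a \<otimes> m a b)"
      using insert.hyps uc mc b by (intro finsum_insert) auto
    then show "u x \<otimes> (m x b \<otimes> w b) \<oplus> (\<Oplus>a\<in>A. u a \<otimes> m a b) \<otimes> w b
        = (\<Oplus>a\<in>insert x A. u a \<otimes> m a b) \<otimes> w b"
      using uc[of x] mc[of x b] wc[OF b] sc[OF b] b by (simp add: l_distr m_assoc)
  qed (use uc mc wc in \<open>auto intro!: finsum_closed\<close>)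
  finally show ?case .
qed

text \<open>Pigeonhole: over a finite field the linear map \<open>L\<close> sends a set of vectors
  with \<open>card J\<close> coordinates into a smaller set, so two vectors collide, and their
  difference solves the system.\<close>

lemma finite_field_homogeneous_system:
  assumes fin: "finite (carrier R)" "finite I" "finite J" and lt: "card I < card J"
    and m: "\<And>i j. i \<in> I \<Longrightarrow> j \<in> J \<Longrightarrow> m i j \<in> carrier R"
  shows "\<exists>w. (\<forall>j\<in>J. w j \<in> carrier R) \<and> (\<exists>j\<in>J. w j \<noteq> \<zero>) \<and> (\<forall>i\<in>I. (\<Oplus>j\<in>J. m i j \<otimes> w j) = \<zero>)"
proof -
  define L where "L = (\<lambda>w. restrict (\<lambda>i. \<Oplus>j\<in>J. m i j \<otimes> w j) I)"
  have "card {\<zero>, \<one>} \<le> card (carrier R)" using fin(1) by (intro card_mono) auto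
  then have "1 < card (carrier R)" by simp
  then have "card (I \<rightarrow>\<^sub>E carrier R) < card (J \<rightarrow>\<^sub>E carrier R)"
    using fin lt by (simp add: card_PiE)
  moreover have "L ` (J \<rightarrow>\<^sub>E carrier R) \<subseteq> (I \<rightarrow>\<^sub>E carrier R)"
  proof
    fix y assume "y \<in> L ` (J \<rightarrow>\<^sub>E carrier R)"
    then obtain w where w: "w \<in> J \<rightarrow>\<^sub>E carrier R" "y = L w" by blast
    have "(\<Oplus>j\<in>J. m i j \<otimes> w j) \<in> carrier R" if "i \<in> I" for i
      using m[OF that] w(1) by (intro finsum_closed) (auto simp: PiE_mem)
    then show "y \<in> I \<rightarrow>\<^sub>E carrier R" by (auto simp: w(2) L_def)
  qed
  ultimately have "\<not> inj_on L (J \<rightarrow>\<^sub>E carrier R)"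
    using card_inj_on_le[of L "J \<rightarrow>\<^sub>E carrier R" "I \<rightarrow>\<^sub>E carrier R"] fin by (auto simp: finite_PiE)
  then obtain w w' where w: "w \<in> J \<rightarrow>\<^sub>E carrier R" "w' \<in> J \<rightarrow>\<^sub>E carrier R" "L w = L w'" "w \<noteq> w'"
    unfolding inj_on_def by blast
  have wc: "w j \<in> carrier R" "w' j \<in> carrier R" if "j \<in> J" for j
    using w(1,2) that by (auto simp: PiE_mem)
  have "\<exists>j\<in>J. w j \<noteq> w' j" using w(4) PiE_ext[OF w(1,2)] by blast
  then obtain j where j: "j \<in> J" "w j \<noteq> w' j" by blast
  have "w j \<ominus> w' j \<noteq> \<zero>"
  proof
    assume z: "w j \<ominus> w' j = \<zero>"
    have "w j = (w j \<ominus> w' j) \<oplus> w' j" using wc[OF j(1)] by algebra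
    then show False using j wc[OF j(1)] by (simp add: z)
  qed
  then have "\<exists>j\<in>J. w j \<ominus> w' j \<noteq> \<zero>" using j(1) by blast
  moreover have "(\<Oplus>j\<in>J. m i j \<otimes> (w j \<ominus> w' j)) = \<zero>" if i: "i \<in> I" for i
  proof -
    have c: "(\<Oplus>j\<in>J. m i j \<otimes> w' j) \<in> carrier R"
      using m[OF i] wc by (intro finsum_closed) auto
    have c': "(\<Oplus>j\<in>J. m i j \<otimes> (w j \<ominus> w' j)) \<in> carrier R"
      using m[OF i] wc by (intro finsum_closed) auto
    have "(\<Oplus>j\<in>J. m i j \<otimes> w j) = (\<Oplus>j\<in>J. m i j \<otimes> (w j \<ominus> w' j) \<oplus> m i j \<otimes> w' j)"
    proof (rule finsum_cong')
      fix j assume j: "j \<in> J"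
      then show "m i j \<otimes> w j = m i j \<otimes> (w j \<ominus> w' j) \<oplus> m i j \<otimes> w' j"
        using m[OF i j] wc[OF j] by algebra
    qed (use m[OF i] wc in auto)
    also have "\<dots> = (\<Oplus>j\<in>J. m i j \<otimes> (w j \<ominus> w' j)) \<oplus> (\<Oplus>j\<in>J. m i j \<otimes> w' j)"
      using m[OF i] wc by (intro finsum_addf) auto
    finally have "(\<Oplus>j\<in>J. m i j \<otimes> w j)
      = (\<Oplus>j\<in>J. m i j \<otimes> (w j \<ominus> w' j)) \<oplus> (\<Oplus>j\<in>J. m i j \<otimes> w' j)" .
    moreover have "(\<Oplus>j\<in>J. m i j \<otimes> w j) = (\<Oplus>j\<in>J. m i j \<otimes> w' j)"
      using fun_cong[OF w(3), of i] i by (simp add: L_def)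
    ultimately have "(\<Oplus>j\<in>J. m i j \<otimes> w' j)
      = (\<Oplus>j\<in>J. m i j \<otimes> (w j \<ominus> w' j)) \<oplus> (\<Oplus>j\<in>J. m i j \<otimes> w' j)" by simp
    then show ?thesis using add.right_cancel[OF c c' zero_closed] c by simp
  qed
  ultimately show ?thesis using wc by (intro exI[of _ "\<lambda>j. w j \<ominus> w' j"]) auto
qed

lemma add_pow_int_0: "add_pow R (0::int) x = \<zero>"
  by (simp add: add_pow_def)

lemma finsum_int_multiples:
  "finite A \<Longrightarrow> (\<Oplus>a\<in>A. add_pow R (c a :: int) \<one>) = add_pow R (\<Sum>a\<in>A. c a) \<one>"
proof (induction A rule: finite_induct)
  case empty
  show ?case by (simp add: add_pow_int_0)
next
  case (insert x A)
  then show ?case by (simp add: add.int_pow_mult)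
qed

text \<open>A rational relation can be scaled to an integral one with coprime coefficients, and by Bezout these
  do not all vanish in the field, whatever its characteristic.\<close>

lemma indep_cols_adjacency_if_indep_in_field:
  assumes J: "finite J"
    and indep: "\<And>c. (\<And>f. f \<in> J \<Longrightarrow> c f \<in> carrier R) \<Longrightarrow>
      (\<And>e. e \<in> A \<Longrightarrow> (\<Oplus>f\<in>J. c f \<otimes> (if (e, f) \<in> E then \<one> else \<zero>)) = \<zero>) \<Longrightarrow>
      \<forall>f\<in>J. c f = \<zero>"
  shows "indep_cols A J (adjacency E :: _ \<Rightarrow> _ \<Rightarrow> rat)"
  unfolding indep_cols_def
proof (intro allI impI, rule ccontr)
  fix c :: "_ \<Rightarrow> rat"
  assume c: "\<forall>e\<in>A. (\<Sum>f\<in>J. c f * adjacency E e f) = 0" and nz: "\<not> (\<forall>f\<in>J. c f = 0)"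
  obtain d :: int where d: "d \<noteq> 0" "\<And>f. f \<in> J \<Longrightarrow> of_int d * c f \<in> \<int>"
    using common_denominator[of "c ` J"] J by auto
  define z0 where "z0 = (\<lambda>f. \<lfloor>of_int d * c f\<rfloor>)"
  have z0: "rat_of_int (z0 f) = of_int d * c f" if "f \<in> J" for f
    using d(2)[OF that] by (simp add: z0_def)
  define G where "G = Gcd (z0 ` J)"
  have "\<exists>f\<in>J. z0 f \<noteq> 0" using nz z0 d(1) by force
  then have G: "G \<noteq> 0" by (auto simp: G_def Gcd_0_iff)
  define z where "z = (\<lambda>f. z0 f div G)"
  have z: "z0 f = G * z f" if "f \<in> J" for f
    using that by (simp add: z_def G_def Gcd_dvd)
  obtain a where a: "(\<Sum>f\<in>J. a f * z0 f) = G" using bezout_sum[OF J] unfolding G_def by blast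
  have "(\<Sum>f\<in>J. a f * z0 f) = G * (\<Sum>f\<in>J. a f * z f)"
    unfolding sum_distrib_left using z by (intro sum.cong) auto
  then have a1: "(\<Sum>f\<in>J. a f * z f) = 1" using a G by simp
  have rel: "(\<Sum>f\<in>J. z f * (if (e, f) \<in> E then 1 else 0)) = 0" if e: "e \<in> A" for e
  proof -
    have "rat_of_int (G * (\<Sum>f\<in>J. z f * (if (e, f) \<in> E then 1 else 0)))
        = rat_of_int (\<Sum>f\<in>J. z0 f * (if (e, f) \<in> E then 1 else 0))"
      unfolding sum_distrib_left using z by (intro arg_cong[of _ _ rat_of_int] sum.cong) auto
    also have "\<dots> = (\<Sum>f\<in>J. of_int d * (c f * adjacency E e f))"
      unfolding of_int_sum using z0 by (intro sum.cong) (auto simp: adjacency_def)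
    also have "\<dots> = 0" using c e by (simp add: sum_distrib_left[symmetric])
    finally have "G * (\<Sum>f\<in>J. z f * (if (e, f) \<in> E then 1 else 0)) = 0" by (simp only: of_int_eq_0_iff)
    then show ?thesis using G by simp
  qed
  \<comment> \<open>The images of the coprime integers in the field form a relation, so by
    \<open>indep\<close> they all vanish; the Bezout combination then forces
    \<open>\<one> = \<zero>\<close>.\<close>
  have "\<forall>f\<in>J. add_pow R (z f) \<one> = \<zero>"
  proof (rule indep)
    fix e assume e: "e \<in> A"
    have "(\<Oplus>f\<in>J. add_pow R (z f) \<one> \<otimes> (if (e, f) \<in> E then \<one> else \<zero>))
        = (\<Oplus>f\<in>J. add_pow R (z f * (if (e, f) \<in> E then 1 else 0)) \<one>)"
      by (intro finsum_cong') (auto simp: add_pow_int_0)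
    also have "\<dots> = \<zero>"
      by (simp only: finsum_int_multiples[OF J] rel[OF e] add_pow_int_0)
    finally show "(\<Oplus>f\<in>J. add_pow R (z f) \<one> \<otimes> (if (e, f) \<in> E then \<one> else \<zero>)) = \<zero>" .
  qed simp
  then have "add_pow R (a f * z f) \<one> = \<zero>" if "f \<in> J" for f
    using that add.int_pow_pow[of \<one> "a f" "z f"] add.int_pow_one[of "a f"] by (simp add: mult.commute)
  then have "(\<Oplus>f\<in>J. add_pow R (a f * z f) \<one>) = (\<Oplus>f\<in>J. \<zero>)"
    by (intro finsum_cong') auto
  then have "add_pow R (1::int) \<one> = \<zero>"
    by (simp add: finsum_int_multiples[OF J] a1)
  then show False using add.int_pow_1[of \<one>] by simp
qed

end

context acyclic_adt
begin

text \<open>If fewer columns than \<open>card D\<close> spanned the cut over the field, a nonzero combination of the processes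
  in \<open>D\<close> would be invisible on the far side of the cut.\<close>

lemma established_le_cut_rank:
  fixes F :: "nat ring" and XS :: "'k set"
  assumes F: "field F" "finite (carrier F)"
    and code: "code_establishes F V Ip Op E S XS C \<alpha> \<beta> \<epsilon> Y"
    and XS: "finite XS" and \<Omega>: "\<Omega> \<subseteq> V" "S \<in> \<Omega>" and D: "D \<subseteq> XS"
    and demand: "\<And>x. x \<in> D \<Longrightarrow> \<exists>t X'. (t, X') \<in> C \<and> x \<in> X' \<and> t \<in> V - \<Omega>"
  shows "card D \<le> rk (\<Union>(Op ` \<Omega>)) (\<Union>(Ip ` (V - \<Omega>))) (adjacency E :: _ \<Rightarrow> _ \<Rightarrow> rat)"
proof -
  interpret field F by (rule F(1))
  note c1 = conjunct2[OF code[unfolded code_establishes_def]]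
  note c2 = conjunct2[OF c1] note c3 = conjunct2[OF c2] note c4 = conjunct2[OF c3] note c5 = conjunct2[OF c4]
  have \<beta>c: "\<beta> f e \<in> carrier F" for f e using conjunct1[OF c1] by simp
  have \<epsilon>c: "\<epsilon> f t x \<in> carrier F" for f t x using conjunct1[OF c2] by simp
  have Yc: "Y p k \<in> carrier F" for p k using conjunct1[OF c3] by simp
  have out: "Y e k = (\<Oplus>\<^bsub>F\<^esub>e'\<in>Ip v. \<beta> e' e \<otimes>\<^bsub>F\<^esub> Y e' k) \<oplus>\<^bsub>F\<^esub> (if v = S then \<alpha> k e else \<zero>\<^bsub>F\<^esub>)"
    if "v \<in> V" "e \<in> Op v" "k \<in> XS" for v e k
    by (rule bspec[OF bspec[OF bspec[OF conjunct1[OF c4] that(1)] that(2)] that(3)])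
  have inp: "Y f k = (\<Oplus>\<^bsub>F\<^esub>e\<in>{e. (e, f) \<in> E}. Y e k)"
    if "v \<in> V" "f \<in> Ip v" "k \<in> XS" for v f k
    by (rule bspec[OF bspec[OF bspec[OF conjunct1[OF c5] that(1)] that(2)] that(3)])
  have dec: "(\<Oplus>\<^bsub>F\<^esub>e'\<in>Ip t. \<epsilon> e' t x \<otimes>\<^bsub>F\<^esub> Y e' k) = (if k = x then \<one>\<^bsub>F\<^esub> else \<zero>\<^bsub>F\<^esub>)"
    if "(t, X') \<in> C" "x \<in> X'" "k \<in> XS" for t X' x k
    using bspec[OF conjunct2[OF c5] that(1)] that(2,3) by simp
  define R where "R = \<Union>(Op ` \<Omega>)"
  define R' where "R' = \<Union>(Op ` (V - \<Omega>))"
  define C0 where "C0 = \<Union>(Ip ` (V - \<Omega>))"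
  define a where "a = (\<lambda>e f. if (e, f) \<in> E then \<one>\<^bsub>F\<^esub> else \<zero>\<^bsub>F\<^esub>)"
  \<comment> \<open>Independence over \<open>F\<close>, restated for the record because
    \<open>indep_cols\<close> works in a type-class field.\<close>
  define ind where "ind J \<longleftrightarrow> (\<forall>c. (\<forall>f\<in>J. c f \<in> carrier F) \<longrightarrow>
    (\<forall>e\<in>R. (\<Oplus>\<^bsub>F\<^esub>f\<in>J. c f \<otimes>\<^bsub>F\<^esub> a e f) = \<zero>\<^bsub>F\<^esub>) \<longrightarrow> (\<forall>f\<in>J. c f = \<zero>\<^bsub>F\<^esub>))" for J
  have ac: "a e f \<in> carrier F" for e f by (simp add: a_def)
  have fin: "finite R" "finite R'" "finite C0" "finite D"
    using finite_out_ports[OF \<Omega>(1)] finite_out_ports[of "V - \<Omega>"] finite_in_ports[of "V - \<Omega>"]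
      finite_subset[OF D XS] by (auto simp: R_def R'_def C0_def)
  define indeps where "indeps = {J. J \<subseteq> C0 \<and> ind J}"
  have "finite indeps" using fin(3) by (simp add: indeps_def)
  moreover have "{} \<in> indeps" by (simp add: indeps_def ind_def)
  ultimately have "Max (card ` indeps) \<in> card ` indeps" by (intro Max_in) auto
  \<comment> \<open>A largest set of cut columns that is independent over \<open>F\<close>. Its size
    is at most the rational rank; what remains is that it is at least \<open>card D\<close>.\<close>
  then obtain J0 where J0_max: "J0 \<in> indeps" "card J0 = Max (card ` indeps)" by auto
  have J0: "J0 \<subseteq> C0" "ind J0" using J0_max(1) by (simp_all add: indeps_def)
  have max: "card J \<le> card J0" if "J \<subseteq> C0" "ind J" for J
    unfolding J0_max(2) using \<open>finite indeps\<close> that by (intro Max_ge) (simp_all add: indeps_def)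
  have finJ0: "finite J0" using J0(1) fin(3) by (rule finite_subset)
  have "indep_cols R J0 (adjacency E :: _ \<Rightarrow> _ \<Rightarrow> rat)"
    by (rule indep_cols_adjacency_if_indep_in_field[OF finJ0])
      (use J0(2) in \<open>simp add: ind_def a_def\<close>)
  then have "card J0 \<le> rk R C0 (adjacency E :: _ \<Rightarrow> _ \<Rightarrow> rat)"
    by (rule card_le_rk[OF fin(3) J0(1)])
  moreover have "card D \<le> card J0"
  proof (rule ccontr)
    assume "\<not> ?thesis"
    then have lt: "card J0 < card D" by simp
    \<comment> \<open>\<open>m r k\<close> is what column \<open>r\<close> of the cut receives from
      the near side when only process \<open>k\<close> is 1. With fewer columns than processes, some
      nonzero \<open>w\<close> is unseen by \<open>J0\<close>.\<close>
    define m where "m = (\<lambda>r k. \<Oplus>\<^bsub>F\<^esub>e\<in>R. a e r \<otimes>\<^bsub>F\<^esub> Y e k)"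
    have "m r k \<in> carrier F" for r k unfolding m_def using ac Yc by (intro finsum_closed) auto
    from finite_field_homogeneous_system[where m = m, OF F(2) finJ0 fin(4) lt this] obtain w where
      w: "\<forall>k\<in>D. w k \<in> carrier F" "\<exists>k\<in>D. w k \<noteq> \<zero>\<^bsub>F\<^esub>"
        "\<forall>r\<in>J0. (\<Oplus>\<^bsub>F\<^esub>k\<in>D. m r k \<otimes>\<^bsub>F\<^esub> w k) = \<zero>\<^bsub>F\<^esub>"
      by (elim exE conjE) (rule that)
    have wc: "w k \<in> carrier F" if "k \<in> D" for k using w(1) that by simp
    note w_nz = w(2) and w0 = bspec[OF w(3)]
    \<comment> \<open>The symbol on \<open>p\<close> when the processes in \<open>D\<close> take the
      values \<open>w\<close> and all others are 0.\<close>
    define d where "d = (\<lambda>p. \<Oplus>\<^bsub>F\<^esub>k\<in>D. Y p k \<otimes>\<^bsub>F\<^esub> w k)"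
    have dc: "d p \<in> carrier F" for p unfolding d_def using wc Yc by (intro finsum_closed) auto
    have lin: "(\<Oplus>\<^bsub>F\<^esub>p\<in>A. u p \<otimes>\<^bsub>F\<^esub> d p) = (\<Oplus>\<^bsub>F\<^esub>k\<in>D. (\<Oplus>\<^bsub>F\<^esub>p\<in>A. u p \<otimes>\<^bsub>F\<^esub> Y p k) \<otimes>\<^bsub>F\<^esub> w k)"
      if "finite A" "\<And>p. p \<in> A \<Longrightarrow> u p \<in> carrier F" for A u
      unfolding d_def using finsum_mult_assoc[where m = Y, OF that(1) fin(4) that(2) Yc wc] by simp
    define s where "s = (\<lambda>f. \<Oplus>\<^bsub>F\<^esub>e\<in>R. a e f \<otimes>\<^bsub>F\<^esub> d e)"
    have sc: "s f \<in> carrier F" for f unfolding s_def using ac dc by (intro finsum_closed) auto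
    have s_J0: "s r = \<zero>\<^bsub>F\<^esub>" if "r \<in> J0" for r
      unfolding s_def lin[OF fin(1) ac] using w0[OF that] by (simp add: m_def)
    \<comment> \<open>By maximality every other column of the cut depends on \<open>J0\<close>, so
      the near side contributes nothing to any far input port.\<close>
    have s_C0: "s f = \<zero>\<^bsub>F\<^esub>" if f: "f \<in> C0" for f
    proof (cases "f \<in> J0")
      case True
      then show ?thesis by (rule s_J0)
    next
      case False
      then have "\<not> ind (insert f J0)" using max[of "insert f J0"] f J0(1) finJ0 by auto
      then obtain c where c: "\<forall>g\<in>insert f J0. c g \<in> carrier F"
        "\<forall>e\<in>R. (\<Oplus>\<^bsub>F\<^esub>g\<in>insert f J0. c g \<otimes>\<^bsub>F\<^esub> a e g) = \<zero>\<^bsub>F\<^esub>"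
        "\<not> (\<forall>g\<in>insert f J0. c g = \<zero>\<^bsub>F\<^esub>)"
        unfolding ind_def not_all not_imp by (elim exE conjE) (rule that)
      have cc: "c g \<in> carrier F" if "g \<in> insert f J0" for g using bspec[OF c(1) that] .
      note rel = bspec[OF c(2)]
      have ins: "(\<Oplus>\<^bsub>F\<^esub>g\<in>insert f J0. c g \<otimes>\<^bsub>F\<^esub> h g) = c f \<otimes>\<^bsub>F\<^esub> h f \<oplus>\<^bsub>F\<^esub> (\<Oplus>\<^bsub>F\<^esub>g\<in>J0. c g \<otimes>\<^bsub>F\<^esub> h g)"
        if "\<And>g. h g \<in> carrier F" for h
        using finJ0 False cc that by (intro finsum_insert) auto
      have cf: "c f \<noteq> \<zero>\<^bsub>F\<^esub>"
      proof
        assume cf: "c f = \<zero>\<^bsub>F\<^esub>"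
        have rel0: "\<forall>e\<in>R. (\<Oplus>\<^bsub>F\<^esub>g\<in>J0. c g \<otimes>\<^bsub>F\<^esub> a e g) = \<zero>\<^bsub>F\<^esub>"
        proof
          fix e assume e: "e \<in> R"
          have "(\<Oplus>\<^bsub>F\<^esub>g\<in>J0. c g \<otimes>\<^bsub>F\<^esub> a e g) \<in> carrier F" using cc ac by (intro finsum_closed) auto
          then show "(\<Oplus>\<^bsub>F\<^esub>g\<in>J0. c g \<otimes>\<^bsub>F\<^esub> a e g) = \<zero>\<^bsub>F\<^esub>"
            using rel[OF e] ins[of "a e"] ac by (simp add: cf)
        qed
        have "\<forall>g\<in>J0. c g \<in> carrier F" using c(1) by simp
        from mp[OF mp[OF spec[OF J0(2)[unfolded ind_def], of c] this] rel0]
        have "\<forall>g\<in>J0. c g = \<zero>\<^bsub>F\<^esub>" .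
        then show False using c(3) cf by simp
      qed
      have "(\<Oplus>\<^bsub>F\<^esub>g\<in>J0. c g \<otimes>\<^bsub>F\<^esub> s g) = (\<Oplus>\<^bsub>F\<^esub>g\<in>J0. \<zero>\<^bsub>F\<^esub>)"
        using s_J0 cc by (intro finsum_cong') auto
      then have "c f \<otimes>\<^bsub>F\<^esub> s f = (\<Oplus>\<^bsub>F\<^esub>g\<in>insert f J0. c g \<otimes>\<^bsub>F\<^esub> s g)"
        using ins[of s] sc cc by simp
      also have "\<dots> = (\<Oplus>\<^bsub>F\<^esub>e\<in>R. (\<Oplus>\<^bsub>F\<^esub>g\<in>insert f J0. c g \<otimes>\<^bsub>F\<^esub> a e g) \<otimes>\<^bsub>F\<^esub> d e)"
        unfolding s_def using finJ0 fin(1) cc ac dc by (intro finsum_mult_assoc) auto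
      also have "\<dots> = (\<Oplus>\<^bsub>F\<^esub>e\<in>R. \<zero>\<^bsub>F\<^esub>)"
        using rel dc by (intro finsum_cong') auto
      finally have "c f \<otimes>\<^bsub>F\<^esub> s f = \<zero>\<^bsub>F\<^esub>" by simp
      then show ?thesis using cf cc sc by (simp add: integral_iff)
    qed
    have d_in: "d f = (\<Oplus>\<^bsub>F\<^esub>e\<in>R \<union> R'. a e f \<otimes>\<^bsub>F\<^esub> d e)" if f: "v \<in> V" "f \<in> Ip v" for v f
    proof -
      have "Y f k = (\<Oplus>\<^bsub>F\<^esub>e\<in>R \<union> R'. a e f \<otimes>\<^bsub>F\<^esub> Y e k)" if k: "k \<in> D" for k
      proof -
        have "k \<in> XS" using k D by blast
        have "(\<Oplus>\<^bsub>F\<^esub>e\<in>{e. (e, f) \<in> E}. Y e k) = (\<Oplus>\<^bsub>F\<^esub>e\<in>R \<union> R'. a e f \<otimes>\<^bsub>F\<^esub> Y e k)"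
        proof (rule add.finprod_mono_neutral_cong_left)
          show "{e. (e, f) \<in> E} \<subseteq> R \<union> R'" using edge_ports[of _ f] by (auto simp: R_def R'_def)
        qed (use fin ac Yc in \<open>auto simp: a_def\<close>)
        then show ?thesis using inp[OF f \<open>k \<in> XS\<close>] by simp
      qed
      then have "d f = (\<Oplus>\<^bsub>F\<^esub>k\<in>D. (\<Oplus>\<^bsub>F\<^esub>e\<in>R \<union> R'. a e f \<otimes>\<^bsub>F\<^esub> Y e k) \<otimes>\<^bsub>F\<^esub> w k)"
        unfolding d_def using ac Yc wc by (intro finsum_cong') (auto intro!: finsum_closed)
      then show ?thesis using lin[of "R \<union> R'" "\<lambda>e. a e f"] fin ac by simp
    qed
    have d_out: "d e = (\<Oplus>\<^bsub>F\<^esub>f\<in>Ip u. \<beta> f e \<otimes>\<^bsub>F\<^esub> d f)" if u: "u \<in> V - \<Omega>" "e \<in> Op u" for u e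
    proof -
      have "Y e k = (\<Oplus>\<^bsub>F\<^esub>f\<in>Ip u. \<beta> f e \<otimes>\<^bsub>F\<^esub> Y f k)" if k: "k \<in> D" for k
      proof -
        have "u \<noteq> S" "u \<in> V" "k \<in> XS" using u \<Omega>(2) D k by auto
        moreover have "(\<Oplus>\<^bsub>F\<^esub>f\<in>Ip u. \<beta> f e \<otimes>\<^bsub>F\<^esub> Y f k) \<in> carrier F"
          using \<beta>c Yc by (intro finsum_closed) auto
        ultimately show ?thesis using out[of u e k] u(2) by simp
      qed
      then have "d e = (\<Oplus>\<^bsub>F\<^esub>k\<in>D. (\<Oplus>\<^bsub>F\<^esub>f\<in>Ip u. \<beta> f e \<otimes>\<^bsub>F\<^esub> Y f k) \<otimes>\<^bsub>F\<^esub> w k)"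
        unfolding d_def using \<beta>c Yc wc by (intro finsum_cong') (auto intro!: finsum_closed)
      then show ?thesis using lin[of "Ip u" "\<lambda>f. \<beta> f e"] finite_ports(1)[of u] \<beta>c u(1) by simp
    qed
    \<comment> \<open>Far output ports depend only on far input ports, since the source is near;
      induction along \<open>depth\<close> then shows that the far side receives zero
      everywhere.\<close>
    have d0: "d f = \<zero>\<^bsub>F\<^esub>" if "v \<in> V - \<Omega>" "f \<in> Ip v" for v f
      using that
    proof (induction "depth v" arbitrary: v f rule: less_induct)
      case less
      have "a e f \<otimes>\<^bsub>F\<^esub> d e = \<zero>\<^bsub>F\<^esub>" if e: "e \<in> R'" for e
      proof (cases "(e, f) \<in> E")
        case True
        obtain u where u: "u \<in> V - \<Omega>" "e \<in> Op u" using e by (auto simp: R'_def)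
        have "depth u < depth v" using depth_less[of u v e f] u less.prems True by blast
        then have "d f' = \<zero>\<^bsub>F\<^esub>" if "f' \<in> Ip u" for f' using less.hyps u(1) that by blast
        then have "(\<Oplus>\<^bsub>F\<^esub>f'\<in>Ip u. \<beta> f' e \<otimes>\<^bsub>F\<^esub> d f') = (\<Oplus>\<^bsub>F\<^esub>f'\<in>Ip u. \<zero>\<^bsub>F\<^esub>)"
          using \<beta>c by (intro finsum_cong') auto
        then show ?thesis using d_out[OF u] ac by simp
      next
        case False
        then show ?thesis using dc by (simp add: a_def)
      qed
      then have "(\<Oplus>\<^bsub>F\<^esub>e\<in>R'. a e f \<otimes>\<^bsub>F\<^esub> d e) = (\<Oplus>\<^bsub>F\<^esub>e\<in>R'. \<zero>\<^bsub>F\<^esub>)"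
        by (intro finsum_cong') auto
      then have R'0: "(\<Oplus>\<^bsub>F\<^esub>e\<in>R'. a e f \<otimes>\<^bsub>F\<^esub> d e) = \<zero>\<^bsub>F\<^esub>" by simp
      have "f \<in> C0" using less.prems by (auto simp: C0_def)
      then have R0: "(\<Oplus>\<^bsub>F\<^esub>e\<in>R. a e f \<otimes>\<^bsub>F\<^esub> d e) = \<zero>\<^bsub>F\<^esub>" using s_C0 by (simp add: s_def)
      have disj: "R \<inter> R' = {}"
      proof (rule ccontr)
        assume "R \<inter> R' \<noteq> {}"
        then obtain e u u' where "e \<in> Op u" "u \<in> \<Omega>" "e \<in> Op u'" "u' \<in> V - \<Omega>"
          by (auto simp: R_def R'_def)
        then show False using ports_disjoint(2)[of u u'] \<Omega>(1) by blast
      qed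
      have "(\<Oplus>\<^bsub>F\<^esub>e\<in>R \<union> R'. a e f \<otimes>\<^bsub>F\<^esub> d e)
          = (\<Oplus>\<^bsub>F\<^esub>e\<in>R. a e f \<otimes>\<^bsub>F\<^esub> d e) \<oplus>\<^bsub>F\<^esub> (\<Oplus>\<^bsub>F\<^esub>e\<in>R'. a e f \<otimes>\<^bsub>F\<^esub> d e)"
        using fin disj ac dc by (intro finsum_Un_disjoint) auto
      then show ?case using d_in[of v f] less.prems by (simp add: R0 R'0)
    qed
    \<comment> \<open>Decoding \<open>x\<close> must return \<open>w x\<close>, yet zero symbols
      decode to zero; over all of \<open>D\<close> this contradicts the choice of
      \<open>w\<close>.\<close>
    have "w x = \<zero>\<^bsub>F\<^esub>" if x: "x \<in> D" for x
    proof -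
      obtain t X' where t: "(t, X') \<in> C" "x \<in> X'" "t \<in> V - \<Omega>" using demand[OF x] by blast
      have "finite (Ip t)" using finite_ports(1) t(3) by simp
      have "(\<Oplus>\<^bsub>F\<^esub>f\<in>Ip t. \<zero>\<^bsub>F\<^esub>) = (\<Oplus>\<^bsub>F\<^esub>f\<in>Ip t. \<epsilon> f t x \<otimes>\<^bsub>F\<^esub> d f)"
        using \<epsilon>c d0[OF t(3)] by (intro finsum_cong') auto
      also have "\<dots> = (\<Oplus>\<^bsub>F\<^esub>k\<in>D. (\<Oplus>\<^bsub>F\<^esub>f\<in>Ip t. \<epsilon> f t x \<otimes>\<^bsub>F\<^esub> Y f k) \<otimes>\<^bsub>F\<^esub> w k)"
        by (rule lin[OF \<open>finite (Ip t)\<close> \<epsilon>c])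
      also have "\<dots> = (\<Oplus>\<^bsub>F\<^esub>k\<in>D. if x = k then w k else \<zero>\<^bsub>F\<^esub>)"
      proof (rule finsum_cong')
        fix k assume k: "k \<in> D"
        then have "k \<in> XS" using D by blast
        from dec[OF t(1,2) this]
        show "(\<Oplus>\<^bsub>F\<^esub>f\<in>Ip t. \<epsilon> f t x \<otimes>\<^bsub>F\<^esub> Y f k) \<otimes>\<^bsub>F\<^esub> w k = (if x = k then w k else \<zero>\<^bsub>F\<^esub>)"
          using wc[OF k] by auto
      qed (use wc in auto)
      also have "\<dots> = w x" using x fin(4) wc by (intro finsum_singleton) auto
      finally show ?thesis by simp
    qed
    then show False using w_nz by blast
  qed
  ultimately show ?thesis by (simp add: R_def C0_def)
qed

end

section \<open>Cut conditions and solvability\<close>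

lemma le_mincut_iff:
  assumes "finite V" "S \<in> V" "S \<notin> Ts"
  shows "n \<le> mincut V Ip Op E S Ts \<longleftrightarrow>
    (\<forall>\<Omega>. \<Omega> \<subseteq> V \<and> S \<in> \<Omega> \<and> Ts \<inter> \<Omega> = {} \<longrightarrow> n \<le> mat_rank (cut_matrix V Ip Op E \<Omega>))"
proof -
  let ?cuts = "{\<Omega>. \<Omega> \<subseteq> V \<and> S \<in> \<Omega> \<and> Ts \<inter> \<Omega> = {}}"
  have "finite ?cuts" by (rule finite_subset[of _ "Pow V"]) (use assms(1) in auto)
  \<comment> \<open>The cut \<open>{S}\<close> keeps the set of cuts nonempty, so that
    \<open>Min\<close> is attained.\<close>
  moreover have "{S} \<in> ?cuts" using assms by auto
  then have "?cuts \<noteq> {}" by blast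
  ultimately have "n \<le> Min ((\<lambda>\<Omega>. mat_rank (cut_matrix V Ip Op E \<Omega>)) ` ?cuts)
    \<longleftrightarrow> (\<forall>\<Omega>\<in>?cuts. n \<le> mat_rank (cut_matrix V Ip Op E \<Omega>))"
    by (subst Min_ge_iff) auto
  moreover have "{mat_rank (cut_matrix V Ip Op E \<Omega>) |\<Omega>. \<Omega> \<subseteq> V \<and> S \<in> \<Omega> \<and> Ts \<inter> \<Omega> = {}}
    = (\<lambda>\<Omega>. mat_rank (cut_matrix V Ip Op E \<Omega>)) ` ?cuts" by blast
  ultimately show ?thesis unfolding mincut_def by simp
qed

theorem theorem7:
  fixes V :: "'v set" and Ip Op :: "'v \<Rightarrow> 'p::linorder set" and E :: "('p \<times> 'p) set"
    and S :: 'v and T :: "nat \<Rightarrow> 'v" and N K :: nat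
    and XS :: "'k set" and Xd :: "nat \<Rightarrow> 'k set"
  assumes net: "acyclic_adt_network V Ip Op E"
    and S_in: "S \<in> V"
    and XS_fin: "finite XS"
    and KN: "K \<le> N"
    and T_in: "\<forall>i\<in>{1..N}. T i \<in> V \<and> T i \<noteq> S"
    and T_inj: "inj_on T {1..N}"
    and Xd_sub: "\<forall>i\<in>{1..K}. Xd i \<subseteq> XS"
    and Xd_disj: "\<forall>i\<in>{1..K}. \<forall>j\<in>{1..K}. i \<noteq> j \<longrightarrow> Xd i \<inter> Xd j = {}"
  shows "solvable V Ip Op E S XS
           ({(T i, Xd i) | i. i \<in> {1..K}} \<union> {(T i, XS) | i. i \<in> {K+1..N}})
         \<longleftrightarrow>
         ((\<forall>Ts. Ts \<subseteq> T ` {1..K} \<longrightarrow>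
              mincut V Ip Op E S Ts \<ge> (\<Sum>i\<in>{i\<in>{1..K}. T i \<in> Ts}. card (Xd i))) \<and>
          (\<forall>j\<in>{K+1..N}. mincut V Ip Op E S {T j} \<ge> card XS))"
    (is "solvable _ _ _ _ _ _ ?C \<longleftrightarrow> ?cuts")
proof -
  interpret acyclic_adt V Ip Op E by unfold_locales (rule net)
  let ?r = "\<lambda>\<Omega>. rk (\<Union>(Op ` \<Omega>)) (\<Union>(Ip ` (V - \<Omega>))) (adjacency E :: _ \<Rightarrow> _ \<Rightarrow> rat)"
  have rank: "mat_rank (cut_matrix V Ip Op E \<Omega>) = ?r \<Omega>" if "\<Omega> \<subseteq> V" for \<Omega>
    using mat_rank_cut_matrix[of Op \<Omega> Ip V E] finite_out_ports[OF that] finite_in_ports[of "V - \<Omega>"] by simp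
  have cut_iff: "n \<le> mincut V Ip Op E S Ts \<longleftrightarrow> (\<forall>\<Omega>. \<Omega> \<subseteq> V \<and> S \<in> \<Omega> \<and> Ts \<inter> \<Omega> = {} \<longrightarrow> n \<le> ?r \<Omega>)"
    if "S \<notin> Ts" for n Ts
    unfolding le_mincut_iff[OF finite_nodes S_in that] using rank by auto
  have T_d: "T i \<in> V" "T i \<noteq> S" if "i \<in> {1..K}" for i using T_in KN that by simp_all
  have T_m: "T i \<in> V" "T i \<noteq> S" if "i \<in> {K+1..N}" for i using T_in that by simp_all
  have S_T: "S \<notin> T ` {1..K}" using T_d(2) by blast
  have card_UN: "card (\<Union>i\<in>I. Xd i) = (\<Sum>i\<in>I. card (Xd i))" if "I \<subseteq> {1..K}" for I
  proof (rule card_UN_disjoint)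
    show "finite I" using that finite_subset by blast
    show "\<forall>i\<in>I. finite (Xd i)" using that Xd_sub XS_fin finite_subset by blast
    show "\<forall>i\<in>I. \<forall>j\<in>I. i \<noteq> j \<longrightarrow> Xd i \<inter> Xd j = {}" using that Xd_disj by blast
  qed
  show ?thesis
  proof
    assume "solvable V Ip Op E S XS ?C"
    then obtain F :: "nat ring" and \<alpha> \<beta> \<epsilon> Y where F: "field F" "finite (carrier F)"
      and code: "code_establishes F V Ip Op E S XS ?C \<alpha> \<beta> \<epsilon> Y"
      unfolding solvable_def by (elim exE conjE) (rule that)
    show ?cuts
    proof (intro conjI allI impI ballI)
      fix Ts assume Ts: "Ts \<subseteq> T ` {1..K}"
      define I where "I = {i \<in> {1..K}. T i \<in> Ts}"
      have I: "I \<subseteq> {1..K}" by (auto simp: I_def)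
      \<comment> \<open>Disjoint demands turn the sum of sizes into the size of one union, a single
        set of processes wanted beyond the cut.\<close>
      have "card (\<Union>i\<in>I. Xd i) \<le> ?r \<Omega>" if \<Omega>: "\<Omega> \<subseteq> V" "S \<in> \<Omega>" "Ts \<inter> \<Omega> = {}" for \<Omega>
      proof (rule established_le_cut_rank[OF F code XS_fin \<Omega>(1,2)])
        show "(\<Union>i\<in>I. Xd i) \<subseteq> XS" using Xd_sub by (auto simp: I_def)
        fix x assume "x \<in> (\<Union>i\<in>I. Xd i)"
        then obtain i where i: "i \<in> {1..K}" "T i \<in> Ts" "x \<in> Xd i" by (auto simp: I_def)
        then have "(T i, Xd i) \<in> ?C" by blast
        moreover have "T i \<in> V - \<Omega>" using T_d(1) i \<Omega>(3) by blast
        ultimately show "\<exists>t X'. (t, X') \<in> ?C \<and> x \<in> X' \<and> t \<in> V - \<Omega>" using i(3) by blast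
      qed
      moreover have "S \<notin> Ts" using Ts S_T by blast
      ultimately show "(\<Sum>i\<in>{i \<in> {1..K}. T i \<in> Ts}. card (Xd i)) \<le> mincut V Ip Op E S Ts"
        unfolding I_def[symmetric] card_UN[OF I, symmetric] by (subst cut_iff) auto
    next
      fix j assume j: "j \<in> {K+1..N}"
      have "card XS \<le> ?r \<Omega>" if \<Omega>: "\<Omega> \<subseteq> V" "S \<in> \<Omega>" "{T j} \<inter> \<Omega> = {}" for \<Omega>
      proof (rule established_le_cut_rank[OF F code XS_fin \<Omega>(1,2) subset_refl])
        fix x assume "x \<in> XS"
        moreover have "(T j, XS) \<in> ?C" using j by blast
        moreover have "T j \<in> V - \<Omega>" using T_m(1)[OF j] \<Omega>(3) by blast
        ultimately show "\<exists>t X'. (t, X') \<in> ?C \<and> x \<in> X' \<and> t \<in> V - \<Omega>" by blast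
      qed
      moreover have "S \<notin> {T j}" using T_m(2)[OF j] by simp
      ultimately show "card XS \<le> mincut V Ip Op E S {T j}" by (subst cut_iff) auto
    qed
  next
    assume cuts: ?cuts
    \<comment> \<open>Disjointness makes the chosen index unique. Processes wanted by no disjoint
      destination stay at the source and so never count as crossing a cut.\<close>
    define owner where "owner x = (if \<exists>i\<in>{1..K}. x \<in> Xd i then T (SOME i. i \<in> {1..K} \<and> x \<in> Xd i) else S)" for x
    have owner_Xd: "owner x = T i" if i: "i \<in> {1..K}" "x \<in> Xd i" for x i
    proof -
      have "(SOME i. i \<in> {1..K} \<and> x \<in> Xd i) = i"
      proof (rule some_equality)
        show "j = i" if "j \<in> {1..K} \<and> x \<in> Xd j" for j
          using that i Xd_disj by blast
      qed (use i in simp)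
      then show ?thesis using i by (auto simp: owner_def)
    qed
    have owner_S: "owner x = S" if "\<not> (\<exists>i\<in>{1..K}. x \<in> Xd i)" for x
      using that by (simp add: owner_def)
    have "\<exists>\<alpha> \<beta> Y. integral_code S XS \<alpha> \<beta> Y \<and>
      (\<forall>x\<in>XS. owner x \<noteq> S \<longrightarrow> (\<exists>c. decodes c Y XS (Ip (owner x)) x)) \<and>
      (\<forall>t\<in>T ` {K+1..N}. \<forall>x\<in>XS. \<exists>c. decodes c Y XS (Ip t) x)"
    proof (rule precoded_integral_code_exists[OF S_in XS_fin])
      show "owner x \<in> V" for x
      proof (cases "\<exists>i\<in>{1..K}. x \<in> Xd i")
        case True
        then show ?thesis using owner_Xd T_d(1) by metis
      next
        case False
        then show ?thesis using owner_S S_in by simp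
      qed
      show "T ` {K+1..N} \<subseteq> V" using T_m(1) by blast
    next
      fix \<Omega> assume \<Omega>: "\<Omega> \<subseteq> V" "S \<in> \<Omega>"
      \<comment> \<open>For a given cut the condition is applied to the largest eligible set, all
        disjoint destinations beyond the cut; their demands are exactly the processes with an owner
        there.\<close>
      define Ts where "Ts = T ` {1..K} - \<Omega>"
      define I where "I = {i \<in> {1..K}. T i \<in> Ts}"
      have I: "I \<subseteq> {1..K}" by (auto simp: I_def)
      have "{x \<in> XS. owner x \<notin> \<Omega>} = (\<Union>i\<in>I. Xd i)"
      proof (intro equalityI subsetI)
        fix x assume x: "x \<in> {x \<in> XS. owner x \<notin> \<Omega>}"
        then have "owner x \<noteq> S" using \<Omega>(2) by auto
        then obtain i where i: "i \<in> {1..K}" "x \<in> Xd i" using owner_S[of x] by blast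
        then show "x \<in> (\<Union>i\<in>I. Xd i)" using owner_Xd[OF i] x by (auto simp: I_def Ts_def)
      next
        fix x assume "x \<in> (\<Union>i\<in>I. Xd i)"
        then obtain i where i: "i \<in> {1..K}" "T i \<notin> \<Omega>" "x \<in> Xd i" by (auto simp: I_def Ts_def)
        then show "x \<in> {x \<in> XS. owner x \<notin> \<Omega>}" using owner_Xd[OF i(1,3)] Xd_sub by auto
      qed
      then have "card {x \<in> XS. owner x \<notin> \<Omega>} = (\<Sum>i\<in>{i \<in> {1..K}. T i \<in> Ts}. card (Xd i))"
        using card_UN[OF I] by (simp only: I_def)
      also have "\<dots> \<le> mincut V Ip Op E S Ts" 
        by (rule mp[OF spec[OF conjunct1[OF cuts], of Ts]]) (auto simp: Ts_def)
      finally have "card {x \<in> XS. owner x \<notin> \<Omega>} \<le> mincut V Ip Op E S Ts" .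
      moreover have "S \<notin> Ts" "Ts \<inter> \<Omega> = {}" using S_T by (auto simp: Ts_def)
      ultimately show "card {x \<in> XS. owner x \<notin> \<Omega>} \<le> ?r \<Omega>" using cut_iff \<Omega> by blast
    next
      fix \<Omega> t assume \<Omega>: "\<Omega> \<subseteq> V" "S \<in> \<Omega>" and "t \<in> T ` {K+1..N}"
      then obtain j where j: "j \<in> {K+1..N}" "t = T j" by blast
      then have "card XS \<le> mincut V Ip Op E S {t}" using cuts by blast
      moreover have "S \<notin> {t}" using T_m(2)[OF j(1)] j(2) by simp
      \<comment> \<open>Dropping \<open>t\<close> from the near side gives a cut that separates it
        from the source, so the condition for \<open>{t}\<close> applies even when
        \<open>\<Omega>\<close> contains \<open>t\<close>.\<close>
      moreover have "\<Omega> - {t} \<subseteq> V" "S \<in> \<Omega> - {t}" "{t} \<inter> (\<Omega> - {t}) = {}"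
        using \<Omega> \<open>S \<notin> {t}\<close> by auto
      ultimately show "card XS \<le> ?r (\<Omega> - {t})" using cut_iff by blast
    qed
    then obtain \<alpha> \<beta> Y where code: "integral_code S XS \<alpha> \<beta> Y"
      and dec: "\<forall>x\<in>XS. owner x \<noteq> S \<longrightarrow> (\<exists>c. decodes c Y XS (Ip (owner x)) x)"
        "\<forall>t\<in>T ` {K+1..N}. \<forall>x\<in>XS. \<exists>c. decodes c Y XS (Ip t) x"
      by (elim exE conjE) (rule that)
    show "solvable V Ip Op E S XS ?C"
    proof (rule solvable_if_integral_code[OF XS_fin code])
      fix t X' x assume "(t, X') \<in> ?C" and x: "x \<in> X'"
      then consider i where "i \<in> {1..K}" "t = T i" "X' = Xd i" | j where "j \<in> {K+1..N}" "t = T j" "X' = XS"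
        by blast
      then show "t \<in> V \<and> x \<in> XS \<and> (\<exists>c. decodes c Y XS (Ip t) x)"
      proof cases
        case 1
        then have "owner x = t" "t \<noteq> S" "x \<in> XS" "t \<in> V"
          using owner_Xd[of i x] x T_d[of i] Xd_sub by blast+
        then show ?thesis using dec(1) by blast
      next
        case 2
        then show ?thesis using dec(2) x T_m(1)[of j] by blast
      qed
    qed
  qed
qed

end
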